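(* Let $n\ge 1$, $n<p<\infty$, and let $\rho$ be an admissible measure on $\mathbb{R}^n$. Suppose $S\in\mathcal{S}(n)$ and set $\mu=S_\#\rho$. Assume $u_1,u_2\in\mathcal{D}^{1,p}(\mathbb{R}^n)$ are extremals with $$[u_1]_\rho=\frac{\left|\int_{\mathbb{R}^n}u_1(x)\,d\mu(x)\right|}{\left|\int_{\mathbb{R}^n}x\,d\mu(x)\right|^{1-n/p}},\qquad [u_2]_\rho=\frac{\left|\int_{\mathbb{R}^n}u_2(x)\,d\mu(x)\right|}{\left|\int_{\mathbb{R}^n}x\,d\mu(x)\right|^{1-n/p}},$$ and $$\int_{\mathbb{R}^n}u_1(x)\,d\mu(x)=\int_{\mathbb{R}^n}u_2(x)\,d\mu(x).$$ Then $u_1-u_2$ is constant throughout $\mathbb{R}^n$.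
   Context: $\mathcal{D}^{1,p}(\mathbb{R}^n)$ is the space of $u\in L^1_{\rm loc}(\mathbb{R}^n)$ whose weak partial derivatives $u_{x_i}$, $i=1,\dots,n$, all belong to $L^p(\mathbb{R}^n)$. Since $p>n$, each $u$ is identified with its $(1-n/p)$-Hölder continuous representative. $\|Du\|_p:=\left(\int_{\mathbb{R}^n}|Du|^p\,dx\right)^{1/p}$. An admissible measure is a signed Borel measure $\rho$ on $\mathbb{R}^n$ with compact support, $\rho(\mathbb{R}^n)=0$, and $\int_{\mathbb{R}^n}y\,d\rho(y)\ne 0$. $\mathcal{S}(n)$ is the set of similarity transformations $S(y)=\lambda Oy+z$ of $\mathbb{R}^n$ with $\lambda>0$, $O\in\mathrm{O}(n)$, $z\in\mathbb{R}^n$. The push forward is $(S_\#\rho)(A)=\rho(S^{-1}(A))$ for Borel $A\subset\mathbb{R}^n$. For $u\in\mathcal{D}^{1,p}(\mathbb{R}^n)$, $$[u]_\rho:=\sup\left\{\frac{\left|\int u\,d\mu\right|}{\left|\int x\,d\mu(x)\right|^{1-n/p}}:\ \mu=S_\#\rho,\ S\in\mathcal{S}(n)\right\}.$$ $C_*$ is the smallest constant $C$ such that the generalized Morrey inequality $[u]_\rho\le C\|Du\|_p$ holds for all $u\in\mathcal{D}^{1,p}(\mathbb{R}^n)$. An extremal is a $u\in\mathcal{D}^{1,p}(\mathbb{R}^n)$ with $[u]_\rho=C_*\|Du\|_p$. *)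

theory Defs
  imports "HOL-Analysis.Analysis"
begin

section \<open>The space of functions with weak gradient in L^p\<close>

definition partial_deriv :: "'n::finite \<Rightarrow> (real^'n \<Rightarrow> real) \<Rightarrow> real^'n \<Rightarrow> real" where
  "partial_deriv i f x = frechet_derivative f (at x) (axis i 1)"

primrec C_k :: "nat \<Rightarrow> (real^'n::finite \<Rightarrow> real) \<Rightarrow> bool" where
  "C_k 0 f \<longleftrightarrow> continuous_on UNIV f"
| "C_k (Suc k) f \<longleftrightarrow> (\<forall>x. f differentiable (at x)) \<and> (\<forall>i. C_k k (partial_deriv i f))"

definition test_function :: "(real^'n::finite \<Rightarrow> real) \<Rightarrow> bool" where
  "test_function \<phi> \<longleftrightarrow> (\<forall>k. C_k k \<phi>) \<and> compact (closure {x. \<phi> x \<noteq> 0})"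

definition locally_integrable :: "(real^'n::finite \<Rightarrow> real) \<Rightarrow> bool" where
  "locally_integrable f \<longleftrightarrow> (\<forall>K. compact K \<longrightarrow> set_integrable lebesgue K f)"

definition weak_partial_deriv ::
    "'n::finite \<Rightarrow> (real^'n \<Rightarrow> real) \<Rightarrow> (real^'n \<Rightarrow> real) \<Rightarrow> bool" where
  "weak_partial_deriv i u g \<longleftrightarrow> locally_integrable g \<and>
     (\<forall>\<phi>. test_function \<phi> \<longrightarrow>
        (LINT x|lebesgue. u x * partial_deriv i \<phi> x) = - (LINT x|lebesgue. g x * \<phi> x))"

definition in_Lp :: "real \<Rightarrow> (real^'n::finite \<Rightarrow> real) \<Rightarrow> bool" where
  "in_Lp p g \<longleftrightarrow> g \<in> borel_measurable lebesgue \<and> integrable lebesgue (\<lambda>x. \<bar>g x\<bar> powr p)"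

text \<open>The requirement of continuity selects the continuous representative in each
  almost-everywhere class; it is unique, and it exists because \<open>p\<close> exceeds the dimension.\<close>

definition D1p :: "real \<Rightarrow> (real^'n::finite \<Rightarrow> real) set" where
  "D1p p = {u. locally_integrable u \<and> continuous_on UNIV u \<and>
               (\<forall>i. \<exists>g. weak_partial_deriv i u g \<and> in_Lp p g)}"

text \<open>The weak gradient is determined only almost everywhere; \<open>weak_grad\<close> picks a
  representative, on which \<open>grad_norm\<close> does not depend.\<close>

definition weak_grad :: "(real^'n::finite \<Rightarrow> real) \<Rightarrow> real^'n \<Rightarrow> real^'n" where
  "weak_grad u = (SOME G. \<forall>i. weak_partial_deriv i u (\<lambda>x. G x $ i))"

definition grad_norm :: "real \<Rightarrow> (real^'n::finite \<Rightarrow> real) \<Rightarrow> real" where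
  "grad_norm p u = (LINT x|lebesgue. norm (weak_grad u x) powr p) powr (1 / p)"

section \<open>Signed Borel measures\<close>

text \<open>A signed Borel measure is a countably additive real-valued set function; only its values on
  Borel sets matter. Infinite values need not be considered here, since a signed measure
  with finite total mass is finite on every Borel set.\<close>

definition signed_borel_measure :: "((real^'n::finite) set \<Rightarrow> real) \<Rightarrow> bool" where
  "signed_borel_measure \<rho> \<longleftrightarrow> \<rho> {} = 0 \<and>
     (\<forall>A :: nat \<Rightarrow> (real^'n) set. range A \<subseteq> sets borel \<longrightarrow> disjoint_family A \<longrightarrow>
        (\<lambda>i. \<rho> (A i)) sums \<rho> (\<Union>i. A i))"

definition signed_support :: "((real^'n::finite) set \<Rightarrow> real) \<Rightarrow> (real^'n) set" where
  "signed_support \<rho> =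
     {x. \<forall>U. open U \<longrightarrow> x \<in> U \<longrightarrow> (\<exists>A \<in> sets borel. A \<subseteq> U \<and> \<rho> A \<noteq> 0)}"

text \<open>The positive part in the Jordan decomposition is
  \<open>A \<mapsto> sup {\<rho> B | B \<subseteq> A Borel}\<close>. The case \<open>B = {}\<close> makes the supremum nonnegative, so that
  the truncation of negative values by \<^const>\<open>ennreal\<close> is harmless. The negative part of
  \<open>\<rho>\<close> is the positive part of \<open>-\<rho>\<close>.\<close>

definition jordan_pos :: "((real^'n::finite) set \<Rightarrow> real) \<Rightarrow> (real^'n) measure" where
  "jordan_pos \<rho> =
     measure_of UNIV (sets borel) (\<lambda>A. SUP B \<in> {B \<in> sets borel. B \<subseteq> A}. ennreal (\<rho> B))"

definition signed_integral ::
    "((real^'n::finite) set \<Rightarrow> real) \<Rightarrow>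
     (real^'n \<Rightarrow> 'b::{banach, second_countable_topology}) \<Rightarrow> 'b" where
  "signed_integral \<rho> f =
     (LINT x|jordan_pos \<rho>. f x) - (LINT x|jordan_pos (\<lambda>A. - \<rho> A). f x)"

definition admissible :: "((real^'n::finite) set \<Rightarrow> real) \<Rightarrow> bool" where
  "admissible \<rho> \<longleftrightarrow> signed_borel_measure \<rho> \<and> compact (signed_support \<rho>) \<and>
     \<rho> UNIV = 0 \<and> signed_integral \<rho> (\<lambda>y. y) \<noteq> 0"

section \<open>The generalized Morrey inequality\<close>

definition similarities :: "(real^'n::finite \<Rightarrow> real^'n) set" where
  "similarities = {S. \<exists>c Q z. c > 0 \<and> orthogonal_matrix Q \<and> S = (\<lambda>y. c *\<^sub>R (Q *v y) + z)}"

definition push_forward ::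
    "(real^'n::finite \<Rightarrow> real^'n) \<Rightarrow> ((real^'n) set \<Rightarrow> real) \<Rightarrow> (real^'n) set \<Rightarrow> real" where
  "push_forward S \<rho> A = \<rho> (S -` A)"

definition morrey_ratio ::
    "real \<Rightarrow> ((real^'n::finite) set \<Rightarrow> real) \<Rightarrow> (real^'n \<Rightarrow> real) \<Rightarrow> real" where
  "morrey_ratio p \<mu> u = \<bar>signed_integral \<mu> u\<bar> /
     norm (signed_integral \<mu> (\<lambda>x. x)) powr (1 - real CARD('n) / p)"

definition morrey_seminorm ::
    "real \<Rightarrow> ((real^'n::finite) set \<Rightarrow> real) \<Rightarrow> (real^'n \<Rightarrow> real) \<Rightarrow> ennreal" where
  "morrey_seminorm p \<rho> u = (SUP S \<in> similarities. ennreal (morrey_ratio p (push_forward S \<rho>) u))"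

text \<open>Seminorm and best constant take values in \<open>[0, \<infinity>]\<close>, so that the
  definitions do not presuppose the finiteness asserted by the generalized Morrey inequality.\<close>

definition best_constant :: "real \<Rightarrow> ((real^'n::finite) set \<Rightarrow> real) \<Rightarrow> ennreal" where
  "best_constant p \<rho> =
     Inf {C. \<forall>u \<in> D1p p. morrey_seminorm p \<rho> u \<le> C * ennreal (grad_norm p u)}"

definition extremal ::
    "real \<Rightarrow> ((real^'n::finite) set \<Rightarrow> real) \<Rightarrow> (real^'n \<Rightarrow> real) \<Rightarrow> bool" where
  "extremal p \<rho> u \<longleftrightarrow> u \<in> D1p p \<and>
     morrey_seminorm p \<rho> u = best_constant p \<rho> * ennreal (grad_norm p u)"

end

theory Submission
  imports Defs
begin

text \<open>Let \<open>v = (u\<^sub>1 + u\<^sub>2) / 2\<close>. The quotient attained by \<open>v\<close> at \<open>\<mu>\<close> is that of \<open>u\<^sub>1\<close>, so the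
  inequality with the best constant \<open>C\<close> gives \<open>C \<parallel>Du\<^sub>1\<parallel> = C \<parallel>Du\<^sub>2\<parallel> \<le> C \<parallel>Dv\<parallel>\<close>. Cancelling \<open>C\<close>, strict
  convexity of the \<open>p\<close>-th power of the norm forces \<open>Du\<^sub>1 = Du\<^sub>2\<close> almost everywhere. Morrey's
  inequality, i.e. \<open>C < \<infinity>\<close>, is not needed: since the seminorms of \<open>u\<^sub>1\<close> and \<open>u\<^sub>2\<close> are attained, hence
  finite, \<open>C = \<infinity>\<close> would make both gradients vanish.\<close>

section \<open>Smooth bump functions\<close>

text \<open>Cancelling \<open>C\<close> also requires \<open>C\<close> to be nonzero, which is where
  the nonvanishing first moment of \<rho> enters: it must be detected by functions of finite
  gradient norm. Smooth compactly supported functions are therefore constructed explicitly. They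
  serve a second time in the fundamental lemma of the calculus of variations, which makes weak
  gradients unique almost everywhere. Since \<open>weak_grad\<close> is an arbitrary choice, this
  uniqueness is what identifies the gradient of the midpoint with the mean of the two gradients. The
  passage from equal gradients to a constant difference goes through translations: integrated
  against a moving test function, the difference of the two functions does not change, so it is
  invariant under translation almost everywhere, and by continuity everywhere. On the measure side,
  everything rests on both Jordan parts being finite and carried by a compact set, so that
  continuous functions are integrable and the integral is additive in the integrand.\<close>

lemma partial_deriv_eq:
  "(f has_derivative f') (at x) \<Longrightarrow> partial_deriv i f x = f' (axis i 1)"
  unfolding partial_deriv_def by (metis frechet_derivative_at)

lemma C_k_imp_continuous:
  "C_k k f \<Longrightarrow> continuous_on UNIV f"
  by (cases k)
    (auto intro!: continuous_at_imp_continuous_on differentiable_imp_continuous_within)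

lemma C_k_SucD: "C_k (Suc k) f \<Longrightarrow> C_k k f"
proof (induction k arbitrary: f)
  case 0
  then show ?case using C_k_imp_continuous[of "Suc 0" f] by simp
next
  case (Suc k)
  from Suc.prems have d: "\<forall>x. f differentiable (at x)"
    and p: "\<And>i. C_k (Suc k) (partial_deriv i f)"
    unfolding C_k.simps(2)[of "Suc k" f] by blast+
  show ?case unfolding C_k.simps(2)[of k f] using d Suc.IH[OF p] by blast
qed

section \<open>Stability of the classes C^k under sums and products\<close>

lemma partial_deriv_add:
  assumes "f differentiable (at x)" "g differentiable (at x)"
  shows "partial_deriv i (\<lambda>x. f x + g x) x = partial_deriv i f x + partial_deriv i g x"
proof -
  obtain f' g' where fg: "(f has_derivative f') (at x)" "(g has_derivative g') (at x)"
    using assms unfolding differentiable_def by blast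
  show ?thesis
    using partial_deriv_eq[OF has_derivative_add[OF fg]] partial_deriv_eq[OF fg(1)]
      partial_deriv_eq[OF fg(2)] by simp
qed

lemma partial_deriv_mult:
  assumes "f differentiable (at x)" "g differentiable (at x)"
  shows "partial_deriv i (\<lambda>x. f x * g x) x
    = f x * partial_deriv i g x + partial_deriv i f x * g x"
proof -
  obtain f' g' where fg: "(f has_derivative f') (at x)" "(g has_derivative g') (at x)"
    using assms unfolding differentiable_def by blast
  show ?thesis
    using partial_deriv_eq[OF has_derivative_mult[OF fg]] partial_deriv_eq[OF fg(1)]
      partial_deriv_eq[OF fg(2)] by simp
qed

lemma C_k_add: "C_k k f \<Longrightarrow> C_k k g \<Longrightarrow> C_k k (\<lambda>x. f x + g x)"
proof (induction k arbitrary: f g)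
  case 0
  then show ?case by (simp add: continuous_on_add)
next
  case (Suc k)
  have "partial_deriv i (\<lambda>x. f x + g x) = (\<lambda>x. partial_deriv i f x + partial_deriv i g x)" for i
    using Suc.prems by (auto intro!: ext partial_deriv_add)
  then show ?case using Suc by simp
qed

lemma C_k_mult: "C_k k f \<Longrightarrow> C_k k g \<Longrightarrow> C_k k (\<lambda>x. f x * g x)"
proof (induction k arbitrary: f g)
  case 0
  then show ?case by (simp add: continuous_on_mult)
next
  case (Suc k)
  have "partial_deriv i (\<lambda>x. f x * g x)
      = (\<lambda>x. f x * partial_deriv i g x + partial_deriv i f x * g x)" for i
    using Suc.prems by (auto intro!: ext partial_deriv_mult)
  moreover have "C_k k f" "C_k k g"
    using Suc.prems by (blast intro: C_k_SucD)+
  ultimately show ?case using Suc by (simp add: C_k_add)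
qed

lemma C_k_const: "C_k k (\<lambda>x. c)"
proof (induction k arbitrary: c)
  case (Suc k)
  have "partial_deriv i (\<lambda>x. c) = (\<lambda>x. 0)" for i :: 'a
    by (rule ext) (simp add: partial_deriv_def)
  then show ?case using Suc by simp
qed simp

lemma C_k_prod: "(\<And>j. j \<in> A \<Longrightarrow> C_k k (f j)) \<Longrightarrow> C_k k (\<lambda>x. \<Prod>j\<in>A. f j x)"
  by (induction A rule: infinite_finite_induct) (auto intro: C_k_mult C_k_const)

text \<open>If each derivative in a family is a combination of two members of the family, then the
  family is closed under differentiation and hence smooth. The index \<open>m\<close> has to vary in
  the induction, because differentiation moves between members.\<close>

lemma C_k_coord:
  fixes j :: "'n::finite"
  assumes "\<And>m t. (h m has_real_derivative h' m t) (at t)"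
    and "\<And>m. \<exists>a b m1 m2. \<forall>t. h' m t = a * h m1 t + b * h m2 t"
  shows "C_k k (\<lambda>x. h m (c * x $ j + d))"
proof (induction k arbitrary: m)
  case 0
  have "continuous_on UNIV (h m)"
    using assms(1) by (meson DERIV_isCont continuous_at_imp_continuous_on)
  then show ?case
    by (auto intro!: continuous_intros continuous_on_compose2[where g="h m" and t=UNIV])
next
  case (Suc k)
  have d: "((\<lambda>x. h m (c * x $ j + d)) has_derivative (\<lambda>y. h' m (c * x $ j + d) * (c * y $ j))) (at x)"
    for x :: "real^'n"
  proof -
    have 1: "((\<lambda>x::real^'n. c * x $ j + d) has_derivative (\<lambda>y. c * y $ j)) (at x)"
      by (auto intro!: derivative_eq_intros bounded_linear.has_derivative[OF bounded_linear_vec_nth])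
    have 2: "(h m has_derivative (\<lambda>y. h' m (c * x $ j + d) * y)) (at (c * x $ j + d))"
      using assms(1)[of m] unfolding has_field_derivative_def .
    show ?thesis using has_derivative_compose[OF 1 2] .
  qed
  obtain a b m1 m2 where ab: "\<And>t. h' m t = a * h m1 t + b * h m2 t" using assms(2) by blast
  have "C_k k (partial_deriv i (\<lambda>x. h m (c * x $ j + d)))" for i :: 'n
  proof -
    let ?e = "c * (axis i 1 :: real^'n) $ j"
    have "partial_deriv i (\<lambda>x. h m (c * x $ j + d))
      = (\<lambda>x. (a * ?e) * h m1 (c * x $ j + d) + (b * ?e) * h m2 (c * x $ j + d))"
      by (rule ext, subst partial_deriv_eq[OF d]) (simp add: ab algebra_simps)
    then show ?thesis using Suc by (auto intro!: C_k_add C_k_mult C_k_const)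
  qed
  then show ?case using d by (auto simp: differentiable_def)
qed

text \<open>The case \<open>m = 0\<close> is the classical smooth function exp(-1/t) that is flat at
  0. The powers of \<open>t\<close> in the denominator are carried along because they appear under
  differentiation, and with them the family is closed.\<close>

definition flat_exp :: "nat \<Rightarrow> real \<Rightarrow> real" where
  "flat_exp m t = (if t > 0 then exp (- (1 / t)) / t ^ m else 0)"

text \<open>The substitution t = 1/x turns the limit from the right into the decay of x^m / exp x at
  infinity.\<close>

lemma flat_exp_tendsto_0: "((\<lambda>t. flat_exp m t) \<longlongrightarrow> 0) (at 0)"
proof -
  have "((\<lambda>t. flat_exp m t) \<longlongrightarrow> 0) (at_right 0)"
  proof -
    have "((\<lambda>x::real. x ^ m / exp x) \<longlongrightarrow> 0) at_top" by (rule tendsto_power_div_exp_0)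
    then have "((\<lambda>t::real. inverse t ^ m / exp (inverse t)) \<longlongrightarrow> 0) (at_right 0)"
      by (rule filterlim_compose[OF _ filterlim_inverse_at_top_right])
    then show ?thesis
      by (rule Lim_transform_eventually)
        (auto simp: eventually_at_filter flat_exp_def exp_minus field_simps)
  qed
  moreover have "((\<lambda>t. flat_exp m t) \<longlongrightarrow> 0) (at_left 0)"
    by (rule Lim_transform_eventually[of "\<lambda>_. 0"])
      (auto simp: eventually_at_filter flat_exp_def)
  ultimately show ?thesis by (simp add: filterlim_split_at)
qed

text \<open>The redundant factor 1 brings the derivative into the shape
  \<open>a * h m1 t + b * h m2 t\<close> that \<open>C_k_coord\<close> expects.\<close>

lemma flat_exp_deriv:
  "(flat_exp m has_real_derivative (- real m) * flat_exp (Suc m) t + 1 * flat_exp (m + 2) t) (at t)"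
proof -
  consider "t > 0" | "t < 0" | "t = 0" by linarith
  then show ?thesis
  proof cases
    case 1
    have *: "((\<lambda>t. exp (- (1 / t)) / t ^ m) has_real_derivative
       (- real m) * flat_exp (Suc m) t + 1 * flat_exp (m + 2) t) (at t)"
    proof -
      \<comment> \<open>Dividing by \<open>t\<close> replaces the exponent \<open>m - Suc 0\<close>,
        which is truncated for \<open>m = 0\<close>.\<close>
      have "real m * t ^ (m - Suc 0) = real m * t ^ m / t"
        using 1 by (cases m) auto
      then have pow: "((\<lambda>t. t ^ m) has_real_derivative real m * t ^ m / t) (at t)"
        using DERIV_pow[of m t] by simp
      have exp: "((\<lambda>t. exp (- (1 / t))) has_real_derivative exp (- (1 / t)) / t ^ 2) (at t)"
        using 1 by (auto intro!: derivative_eq_intros simp: power2_eq_square field_simps)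
      show ?thesis
        by (rule DERIV_cong[OF DERIV_divide[OF exp pow]])
          (use 1 in \<open>auto simp: flat_exp_def power_add power2_eq_square field_simps\<close>)
    qed
    show ?thesis
      by (rule has_field_derivative_transform_within_open[OF *, of "{0<..}"])
        (use 1 in \<open>auto simp: flat_exp_def\<close>)
  next
    case 2
    have *: "((\<lambda>t. 0) has_real_derivative
       (- real m) * flat_exp (Suc m) t + 1 * flat_exp (m + 2) t) (at t)"
      using 2 by (auto simp: flat_exp_def)
    show ?thesis
      by (rule has_field_derivative_transform_within_open[OF *, of "{..<0}"])
        (use 2 in \<open>auto simp: flat_exp_def\<close>)
  next
    case 3
    \<comment> \<open>The difference quotient at 0 is the next member
      \<open>flat_exp (Suc m)\<close> of the family, so its limit is already known.\<close>
    have "((\<lambda>h. flat_exp m h / h) \<longlongrightarrow> 0) (at 0)"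
      by (rule Lim_transform_eventually[OF flat_exp_tendsto_0[of "Suc m"]])
        (auto simp: eventually_at_filter flat_exp_def)
    then show ?thesis using 3 by (simp add: has_field_derivative_iff flat_exp_def)
  qed
qed

lemma C_k_flat_exp: "C_k k (\<lambda>x. flat_exp m (c * x $ j + d))"
  by (rule C_k_coord[OF flat_exp_deriv]) blast

lemma flat_exp_bounds: "0 \<le> flat_exp 0 t" "flat_exp 0 t \<le> 1"
  by (auto simp: flat_exp_def)

text \<open>As \<open>m\<close> tends to infinity these smooth bumps converge boundedly to the indicator of the open
  box.\<close>

definition box_bump :: "nat \<Rightarrow> real^'n::finite \<Rightarrow> real^'n \<Rightarrow> real^'n \<Rightarrow> real" where
  "box_bump m a b x = (\<Prod>i\<in>UNIV. flat_exp 0 (real m * x $ i + - (real m * a $ i)) *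
     flat_exp 0 (- real m * x $ i + real m * b $ i))"

lemma C_k_box_bump: "C_k k (box_bump m a b)"
  unfolding box_bump_def by (intro C_k_prod C_k_mult C_k_flat_exp)

lemma box_bump_bounds: "0 \<le> box_bump m a b x" "box_bump m a b x \<le> 1"
  unfolding box_bump_def
  by (auto intro!: prod_nonneg prod_le_1 mult_nonneg_nonneg mult_le_one flat_exp_bounds)

lemma box_bump_outside:
  assumes "x \<notin> box a b"
  shows "box_bump m a b x = 0"
proof -
  obtain i where "x $ i \<le> a $ i \<or> b $ i \<le> x $ i"
    using assms by (auto simp: mem_box_cart not_less)
  then have "real m * x $ i + - (real m * a $ i) \<le> 0 \<or> - real m * x $ i + real m * b $ i \<le> 0"
    by (auto simp: mult_left_mono)
  then have "flat_exp 0 (real m * x $ i + - (real m * a $ i)) *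
     flat_exp 0 (- real m * x $ i + real m * b $ i) = 0"
    by (auto simp: flat_exp_def)
  then show ?thesis unfolding box_bump_def by (auto intro!: prod_zero)
qed

lemma box_bump_tendsto: "(\<lambda>m. box_bump m a b x) \<longlonglongrightarrow> indicator (box a b) x"
proof (cases "x \<in> box a b")
  case True
  have *: "(\<lambda>m. flat_exp 0 (real m * s)) \<longlonglongrightarrow> 1" if "s > 0" for s
  proof -
    have "(\<lambda>m. exp (- (1 / s) * (1 / real m))) \<longlonglongrightarrow> exp (- (1 / s) * 0)"
      by (intro tendsto_intros lim_1_over_n)
    then have **: "(\<lambda>m. exp (- (1 / s) * (1 / real m))) \<longlonglongrightarrow> 1" by simp
    \<comment> \<open>At \<open>m = 0\<close> the two sequences differ: division by zero makes the
      exponential 1, while \<open>flat_exp 0 0\<close> is 0.\<close>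
    show ?thesis
      by (rule Lim_transform_eventually[OF **], rule eventually_mono[OF eventually_gt_at_top[of 0]])
        (use that in \<open>auto simp: flat_exp_def mult.commute\<close>)
  qed
  have "(\<lambda>m. box_bump m a b x) \<longlonglongrightarrow> (\<Prod>i\<in>(UNIV::'a set). 1 * 1)"
    unfolding box_bump_def
  proof (intro tendsto_prod tendsto_mult)
    fix i
    show "(\<lambda>m. flat_exp 0 (real m * x $ i + - (real m * a $ i))) \<longlonglongrightarrow> 1"
      using *[of "x $ i - a $ i"] True by (simp add: mem_box_cart algebra_simps)
    show "(\<lambda>m. flat_exp 0 (- real m * x $ i + real m * b $ i)) \<longlonglongrightarrow> 1"
      using *[of "b $ i - x $ i"] True by (simp add: mem_box_cart algebra_simps)
  qed
  then show ?thesis using True by simp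
qed (simp add: box_bump_outside)

lemma test_functionI:
  assumes "\<And>k. C_k k f" "\<And>x. x \<notin> K \<Longrightarrow> f x = 0" "compact K"
  shows "test_function f"
proof -
  have "closure {x. f x \<noteq> 0} \<subseteq> K"
    using assms(2,3) by (intro closure_minimal) (auto intro: compact_imp_closed)
  then show ?thesis unfolding test_function_def
    using assms compact_Int_closed[of K "closure {x. f x \<noteq> 0}"] by (auto simp: Int_absorb1)
qed

lemma test_function_box_bump: "test_function (box_bump m a b)"
  by (rule test_functionI[OF C_k_box_bump, of "cbox a b"])
    (use box_subset_cbox[of a b] in \<open>auto intro: box_bump_outside\<close>)

lemma C_k_component: "C_k k (\<lambda>x. x $ j)"
proof (cases k)
  case (Suc l)
  have d: "((\<lambda>x. x $ j) has_derivative (\<lambda>y. y $ j)) (at x)" for x :: "real^'a"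
    by (rule bounded_linear.has_derivative[OF bounded_linear_vec_nth has_derivative_ident])
  have "partial_deriv i (\<lambda>x. x $ j) = (\<lambda>x. (axis i 1 :: real^'a) $ j)" for i
    using partial_deriv_eq[OF d] by auto
  then show ?thesis using Suc d by (auto simp: differentiable_def C_k_const)
qed (simp add: continuous_intros)

lemma test_function_mult:
  assumes "\<And>k. C_k k f" "test_function g"
  shows "test_function (\<lambda>x. f x * g x)"
proof (rule test_functionI[of _ "closure {x. g x \<noteq> 0}"])
  show "f x * g x = 0" if "x \<notin> closure {x. g x \<noteq> 0}" for x
    using that closure_subset[of "{x. g x \<noteq> 0}"] by auto
qed (use assms in \<open>auto simp: test_function_def intro!: C_k_mult\<close>)

text \<open>These are smooth truncations of the coordinate functions. They belong to the class of
  competitors and in the limit see the first moment of \<rho>.\<close>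

lemma test_function_component_bump: "test_function (\<lambda>x. x $ j * box_bump m a b x)"
  by (intro test_function_mult C_k_component test_function_box_bump)

section \<open>Integration by parts against test functions\<close>

lemma test_functionD:
  assumes "test_function \<phi>"
  shows "C_k k \<phi>" "continuous_on UNIV \<phi>" "\<phi> differentiable (at x)"
    "C_k k (partial_deriv i \<phi>)" "continuous_on UNIV (partial_deriv i \<phi>)"
proof -
  have *: "C_k k \<phi>" for k using assms by (simp add: test_function_def)
  show "C_k k \<phi>" "continuous_on UNIV \<phi>" using * C_k_imp_continuous by blast+
  have "C_k (Suc k) \<phi>" for k using * .
  then show "\<phi> differentiable (at x)" and **: "C_k k (partial_deriv i \<phi>)" for k
    unfolding C_k.simps(2) by blast+
  show "continuous_on UNIV (partial_deriv i \<phi>)" using C_k_imp_continuous[OF **] .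
qed

text \<open>One compact set serves the function and all its first derivatives: off the closed
  support the function vanishes on a whole neighbourhood, so its derivative vanishes there as
  well.\<close>

lemma test_function_compact_support:
  assumes "test_function \<phi>"
  obtains K where "compact K" "\<And>x. x \<notin> K \<Longrightarrow> \<phi> x = 0" "\<And>x i. x \<notin> K \<Longrightarrow> partial_deriv i \<phi> x = 0"
proof (rule that[of "closure {x. \<phi> x \<noteq> 0}"])
  let ?K = "closure {x. \<phi> x \<noteq> 0}"
  show "compact ?K" using assms by (simp add: test_function_def)
  show 1: "\<phi> x = 0" if "x \<notin> ?K" for x
    using that closure_subset[of "{x. \<phi> x \<noteq> 0}"] by auto
  show "partial_deriv i \<phi> x = 0" if "x \<notin> ?K" for x i
  proof -
    have "(\<phi> has_derivative (\<lambda>_. 0)) (at x)"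
    proof (rule has_derivative_transform_within_open)
      show "((\<lambda>_. 0) has_derivative (\<lambda>_. 0)) (at x)" by (rule has_derivative_const)
      show "open (- ?K)" by (rule open_Compl[OF closed_closure])
      show "x \<in> - ?K" using that by blast
      show "0 = \<phi> y" if "y \<in> - ?K" for y using 1[of y] that by (metis ComplD)
    qed
    then show ?thesis by (simp add: partial_deriv_eq)
  qed
qed

lemma test_function_partial_deriv:
  assumes "test_function \<phi>"
  shows "test_function (partial_deriv i \<phi>)"
proof -
  obtain K where "compact K" "\<And>x. x \<notin> K \<Longrightarrow> partial_deriv i \<phi> x = 0"
    using test_function_compact_support[OF assms] by metis
  then show ?thesis using test_functionI[OF test_functionD(4)[OF assms]] by blast
qed

lemma partial_deriv_translate:
  assumes "f differentiable (at (x + a))"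
  shows "(\<lambda>x. f (x + a)) differentiable (at x)"
    "partial_deriv i (\<lambda>x. f (x + a)) x = partial_deriv i f (x + a)"
proof -
  obtain f' where f': "(f has_derivative f') (at (x + a))"
    using assms unfolding differentiable_def by blast
  have "((\<lambda>x. x + a) has_derivative (\<lambda>y. y)) (at x)"
    by (auto intro!: derivative_eq_intros)
  from has_derivative_compose[OF this f']
  have *: "((\<lambda>x. f (x + a)) has_derivative f') (at x)" .
  show "(\<lambda>x. f (x + a)) differentiable (at x)" using * by (auto simp: differentiable_def)
  show "partial_deriv i (\<lambda>x. f (x + a)) x = partial_deriv i f (x + a)"
    using partial_deriv_eq[OF *] partial_deriv_eq[OF f'] by simp
qed

lemma C_k_translate: "C_k k f \<Longrightarrow> C_k k (\<lambda>x. f (x + a))"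
proof (induction k arbitrary: f)
  case 0
  then show ?case by (auto intro!: continuous_intros continuous_on_compose2[where g=f and t=UNIV])
next
  case (Suc k)
  have "partial_deriv i (\<lambda>x. f (x + a)) = (\<lambda>x. partial_deriv i f (x + a))" for i
    using Suc.prems by (auto intro!: ext partial_deriv_translate)
  then show ?case using Suc by (simp add: partial_deriv_translate)
qed

lemma test_function_translate:
  assumes "test_function \<phi>"
  shows "test_function (\<lambda>x. \<phi> (x + a))"
proof -
  obtain K where K: "compact K" "\<And>x. x \<notin> K \<Longrightarrow> \<phi> x = 0"
    using test_function_compact_support[OF assms] by metis
  show ?thesis
  proof (rule test_functionI[of _ "(\<lambda>x. x + (- a)) ` K"])
    show "compact ((\<lambda>x. x + (- a)) ` K)"
      by (intro compact_continuous_image K continuous_intros)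
    show "\<phi> (x + a) = 0" if "x \<notin> (\<lambda>x. x + (- a)) ` K" for x
      using that by (intro K(2)) (auto simp: image_iff)
  qed (use assms in \<open>auto intro: C_k_translate test_functionD(1)\<close>)
qed

lemma has_real_derivative_partial_deriv:
  fixes f :: "real^'n::finite \<Rightarrow> real"
  assumes "f differentiable (at (x + t *\<^sub>R axis i 1))"
  shows "((\<lambda>s. f (x + s *\<^sub>R axis i 1)) has_real_derivative partial_deriv i f (x + t *\<^sub>R axis i 1)) (at t)"
proof -
  obtain f' where f': "(f has_derivative f') (at (x + t *\<^sub>R axis i 1))"
    using assms unfolding differentiable_def by blast
  have "((\<lambda>s. x + s *\<^sub>R axis i 1) has_derivative (\<lambda>s. s *\<^sub>R axis i 1)) (at t)"
    by (auto intro!: derivative_eq_intros)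
  from has_derivative_compose[OF this f']
  have "((\<lambda>s. f (x + s *\<^sub>R axis i 1)) has_derivative (\<lambda>s. f' (s *\<^sub>R axis i 1))) (at t)" .
  moreover have "f' (s *\<^sub>R axis i 1) = partial_deriv i f (x + t *\<^sub>R axis i 1) * s" for s
    using partial_deriv_eq[OF f'] linear_scale[OF has_derivative_linear[OF f']] by simp
  ultimately show ?thesis by (simp add: has_field_derivative_def)
qed

section \<open>Local integrability and products with compactly supported functions\<close>

lemma locally_integrable_measurable:
  assumes "locally_integrable g"
  shows "g \<in> borel_measurable lebesgue"
proof (rule borel_measurable_LIMSEQ_real)
  show "(\<lambda>x. indicator (cball 0 (real N)) x * g x) \<in> borel_measurable lebesgue" for N
    using assms[unfolded locally_integrable_def, rule_format, OF compact_cball, of 0 "real N"]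
    by (auto simp: set_integrable_def dest!: borel_measurable_integrable)
  show "(\<lambda>N. indicator (cball 0 (real N)) x * g x) \<longlonglongrightarrow> g x" for x
  proof (rule tendsto_eventually)
    show "eventually (\<lambda>N. indicator (cball 0 (real N)) x * g x = g x) sequentially"
      using eventually_ge_at_top[of "nat \<lceil>norm x\<rceil>"]
      by eventually_elim (auto simp: indicator_def)
  qed
qed

lemma continuous_imp_locally_integrable:
  assumes "continuous_on UNIV u"
  shows "locally_integrable u"
  unfolding locally_integrable_def
proof (intro allI impI)
  fix K :: "(real^'a) set" assume K: "compact K"
  obtain a where "K \<subseteq> cbox (- a) a" using bounded_subset_cbox_symmetric[OF compact_imp_bounded[OF K]] by blast
  moreover have "set_integrable lebesgue (cbox (- a) a) u"
    by (intro absolutely_integrable_continuous continuous_on_subset[OF assms]) auto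
  ultimately show "set_integrable lebesgue K u"
    using set_integrable_subset K by (metis lmeasurable_compact fmeasurableD)
qed

text \<open>The factor \<open>f\<close> is merely bounded and measurable, not a test function, so
  that indicators of boxes and powers of derivatives are covered too.\<close>

lemma integrable_locally_integrable_mult:
  assumes g: "locally_integrable g" and K: "compact K"
    and f: "f \<in> borel_measurable lebesgue" "\<And>x. \<bar>f x\<bar> \<le> B" "\<And>x. x \<notin> K \<Longrightarrow> f x = 0"
  shows "integrable lebesgue (\<lambda>x. g x * f x)"
proof (rule Bochner_Integration.integrable_bound)
  show "integrable lebesgue (\<lambda>x. B * (indicator K x * g x))"
    using g K by (auto simp: locally_integrable_def set_integrable_def)
  show "(\<lambda>x. g x * f x) \<in> borel_measurable lebesgue"
    using f locally_integrable_measurable[OF g] by measurable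
  show "AE x in lebesgue. norm (g x * f x) \<le> norm (B * (indicator K x * g x))"
  proof (rule AE_I2)
    fix x
    show "norm (g x * f x) \<le> norm (B * (indicator K x * g x))"
      using f(2)[of x] f(3)[of x] mult_right_mono[of "\<bar>f x\<bar>" "\<bar>B\<bar>" "\<bar>g x\<bar>"]
      by (cases "x \<in> K") (auto simp: abs_mult mult.commute)
  qed
qed

lemma continuous_lebesgue_measurable:
  "continuous_on UNIV f \<Longrightarrow> f \<in> borel_measurable lebesgue"
  by (simp add: borel_measurable_continuous_onI measurable_completion)

lemma test_function_bounded:
  assumes "test_function \<phi>"
  obtains B where "\<And>x. \<bar>\<phi> x\<bar> \<le> B"
proof -
  obtain K where K: "compact K" "\<And>x. x \<notin> K \<Longrightarrow> \<phi> x = 0"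
    using test_function_compact_support[OF assms] by metis
  have "compact (\<phi> ` K)"
    using K(1) test_functionD(2)[OF assms] by (meson compact_continuous_image continuous_on_subset subset_UNIV)
  then obtain B where "\<And>y. y \<in> \<phi> ` K \<Longrightarrow> norm y \<le> B"
    using compact_imp_bounded bounded_iff by metis
  then have "\<And>x. x \<in> K \<Longrightarrow> \<bar>\<phi> x\<bar> \<le> B" by auto
  then have "\<bar>\<phi> x\<bar> \<le> max B 0" for x
    using K(2)[of x] by (cases "x \<in> K") (simp_all add: le_max_iff_disj)
  then show thesis using that by blast
qed

lemma integrable_mult_test_function:
  assumes "locally_integrable g" "test_function \<phi>"
  shows "integrable lebesgue (\<lambda>x. g x * \<phi> x)"
proof -
  obtain K where K: "compact K" "\<And>x. x \<notin> K \<Longrightarrow> \<phi> x = 0"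
    using test_function_compact_support[OF assms(2)] by metis
  obtain B where B: "\<And>x. \<bar>\<phi> x\<bar> \<le> B" using test_function_bounded[OF assms(2)] by blast
  show ?thesis
    by (rule integrable_locally_integrable_mult[OF assms(1) K(1)
          continuous_lebesgue_measurable[OF test_functionD(2)[OF assms(2)]] B K(2)])
qed

lemma lebesgue_integral_eq_integral_cbox:
  fixes f :: "real^'n::finite \<Rightarrow> real"
  assumes "continuous_on UNIV f" "\<And>x. x \<notin> cbox a b \<Longrightarrow> f x = 0"
  shows "(LINT x|lebesgue. f x) = integral (cbox a b) f"
proof -
  have "(LINT x|lebesgue. f x) = set_lebesgue_integral lebesgue (cbox a b) f"
    unfolding set_lebesgue_integral_def
    by (rule Bochner_Integration.integral_cong) (use assms(2) in \<open>auto simp: indicator_def\<close>)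
  also have "\<dots> = integral (cbox a b) f"
    by (intro set_lebesgue_integral_eq_integral absolutely_integrable_continuous
        continuous_on_subset[OF assms(1)]) auto
  finally show ?thesis .
qed

text \<open>Since \<open>u\<close> is only continuous, the translation acts on \<phi> and the
  differentiability comes from there. Differentiation under the integral sign wants a fixed compact
  domain, hence the restriction of \<open>s\<close> to a bounded interval around
  \<open>t\<close>.\<close>

lemma has_real_derivative_integral_translate:
  fixes u :: "real^'n::finite \<Rightarrow> real"
  assumes u: "continuous_on UNIV u" and \<phi>: "test_function \<phi>"
  shows "((\<lambda>s. LINT x|lebesgue. u x * \<phi> (x + s *\<^sub>R axis i 1)) has_real_derivative
    (LINT x|lebesgue. u x * partial_deriv i \<phi> (x + t *\<^sub>R axis i 1))) (at t)"
proof -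
  let ?e = "axis i 1 :: real^'n"
  note cont = test_functionD(2)[OF \<phi>] test_functionD(5)[OF \<phi>, of i]
  obtain K where K: "compact K" "\<And>x. x \<notin> K \<Longrightarrow> \<phi> x = 0" "\<And>x. x \<notin> K \<Longrightarrow> partial_deriv i \<phi> x = 0"
    using test_function_compact_support[OF \<phi>] by metis
  let ?U = "{t - 1 .. t + 1}"
  \<comment> \<open>The box \<open>cbox (- a) a\<close> is chosen to contain the support shifted by
    every \<open>s\<close> in \<open>?U\<close> at once.\<close>
  have "compact ((\<lambda>(x, s). x - s *\<^sub>R ?e) ` (K \<times> ?U))"
    by (intro compact_continuous_image compact_Times K(1) compact_Icc)
      (auto simp: case_prod_beta intro!: continuous_intros)
  then obtain a where a: "(\<lambda>(x, s). x - s *\<^sub>R ?e) ` (K \<times> ?U) \<subseteq> cbox (- a) a"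
    using bounded_subset_cbox_symmetric compact_imp_bounded by blast
  have out: "x + s *\<^sub>R ?e \<notin> K" if "s \<in> ?U" "x \<notin> cbox (- a) a" for x s
  proof
    assume "x + s *\<^sub>R ?e \<in> K"
    then have "(\<lambda>(x, s). x - s *\<^sub>R ?e) (x + s *\<^sub>R ?e, s) \<in> cbox (- a) a"
      using a that(1) by blast
    then show False using that(2) by simp
  qed
  have c: "continuous_on UNIV (\<lambda>x. u x * f (x + s *\<^sub>R ?e))" if "continuous_on UNIV f" for f :: "real^'n \<Rightarrow> real" and s
    by (intro continuous_intros u continuous_on_compose2[OF that]) auto
  have eq: "(LINT x|lebesgue. u x * f (x + s *\<^sub>R ?e)) = integral (cbox (- a) a) (\<lambda>x. u x * f (x + s *\<^sub>R ?e))"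
    if "continuous_on UNIV f" "\<And>x. x \<notin> K \<Longrightarrow> f x = 0" "s \<in> ?U" for f s
  proof (rule lebesgue_integral_eq_integral_cbox[OF c[OF that(1)]])
    show "u x * f (x + s *\<^sub>R ?e) = 0" if "x \<notin> cbox (- a) a" for x
      using \<open>\<And>x. x \<notin> K \<Longrightarrow> f x = 0\<close>[OF out[OF \<open>s \<in> ?U\<close> that]] by simp
  qed
  have "((\<lambda>s. integral (cbox (- a) a) (\<lambda>x. u x * \<phi> (x + s *\<^sub>R ?e))) has_real_derivative
      integral (cbox (- a) a) (\<lambda>x. u x * partial_deriv i \<phi> (x + t *\<^sub>R ?e))) (at t within ?U)"
  proof (rule leibniz_rule_field_derivative)
    show "((\<lambda>s. u x * \<phi> (x + s *\<^sub>R ?e)) has_real_derivative u x * partial_deriv i \<phi> (x + s *\<^sub>R ?e)) (at s within ?U)"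
      for x s
      by (intro DERIV_cmult has_field_derivative_at_within[OF has_real_derivative_partial_deriv]
          test_functionD(3)[OF \<phi>])
    show "(\<lambda>x. u x * \<phi> (x + s *\<^sub>R ?e)) integrable_on cbox (- a) a" for s
      by (intro integrable_continuous continuous_on_subset[OF c[OF cont(1)]]) auto
    show "continuous_on (?U \<times> cbox (- a) a) (\<lambda>(s, x). u x * partial_deriv i \<phi> (x + s *\<^sub>R ?e))"
      unfolding case_prod_beta
      by (intro continuous_intros continuous_on_compose2[OF u] continuous_on_compose2[OF cont(2)]) auto
  qed auto
  moreover have "at t within ?U = at t" by (rule at_within_interior) simp
  ultimately have "((\<lambda>s. integral (cbox (- a) a) (\<lambda>x. u x * \<phi> (x + s *\<^sub>R ?e))) has_real_derivative
      (LINT x|lebesgue. u x * partial_deriv i \<phi> (x + t *\<^sub>R ?e))) (at t)"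
    using eq[OF cont(2) K(3), of t] by simp
  then show ?thesis
    by (rule has_field_derivative_transform_within_open[of _ _ _ "{t - 1 <..< t + 1}"])
      (auto simp: eq[OF cont(1) K(2)])
qed

lemma integral_translate:
  fixes f :: "real^'n::finite \<Rightarrow> real"
  assumes "continuous_on UNIV f"
  shows "(LINT x|lebesgue. f (x + a)) = (LINT x|lebesgue. f x)"
proof -
  have f: "f \<in> borel_measurable lborel" using borel_measurable_continuous_onI[OF assms] by simp
  have "(LINT x|lebesgue. f (x + a)) = (LINT x|lborel. f (a + x))"
    using f by (subst integral_completion) (auto simp: add.commute)
  also have "\<dots> = (LINT x|distr lborel borel ((+) a). f x)"
    using f by (subst integral_distr) auto
  also have "\<dots> = (LINT x|lebesgue. f x)"
    using f by (simp add: lborel_distr_plus integral_completion)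
  finally show ?thesis .
qed

text \<open>By translation invariance the integral of a translate of \<phi> is constant in the
  shift, and its derivative in the shift is the integral of the partial derivative. This is the case
  \<open>u = 1\<close> of the preceding differentiation rule.\<close>

lemma integral_partial_deriv_test_function:
  assumes "test_function \<phi>"
  shows "(LINT x|lebesgue. partial_deriv i \<phi> x) = 0"
proof -
  have "(LINT x|lebesgue. 1 * \<phi> (x + s *\<^sub>R axis i 1)) = (LINT x|lebesgue. \<phi> x)" for s
    using integral_translate[OF test_functionD(2)[OF assms]] by simp
  then have "((\<lambda>s::real. LINT x|lebesgue. \<phi> x) has_real_derivative
      (LINT x|lebesgue. 1 * partial_deriv i \<phi> (x + 0 *\<^sub>R axis i 1))) (at 0)"
    using has_real_derivative_integral_translate[OF continuous_on_const assms, of 1 i 0] by simp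
  from DERIV_unique[OF this DERIV_const] show ?thesis by simp
qed

text \<open>Integration by parts: the product of \<phi> and \<psi> is again a test function, so its
  partial derivative integrates to 0, and the product rule splits that integral.\<close>

lemma weak_partial_deriv_test_function:
  assumes "test_function \<phi>"
  shows "weak_partial_deriv i \<phi> (partial_deriv i \<phi>)"
  unfolding weak_partial_deriv_def
proof (intro conjI allI impI)
  show "locally_integrable (partial_deriv i \<phi>)"
    by (rule continuous_imp_locally_integrable[OF test_functionD(5)[OF assms]])
  fix \<psi> :: "real^'a \<Rightarrow> real" assume \<psi>: "test_function \<psi>"
  have "(LINT x|lebesgue. \<phi> x * partial_deriv i \<psi> x + partial_deriv i \<phi> x * \<psi> x) = 0"
    using integral_partial_deriv_test_function[OF test_function_mult[OF test_functionD(1)[OF assms] \<psi>], of i]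
    by (simp add: partial_deriv_mult test_functionD(3)[OF assms] test_functionD(3)[OF \<psi>])
  moreover have "integrable lebesgue (\<lambda>x. \<phi> x * partial_deriv i \<psi> x)"
    by (rule integrable_mult_test_function[OF continuous_imp_locally_integrable[OF
          test_functionD(2)[OF assms]] test_function_partial_deriv[OF \<psi>]])
  moreover have "integrable lebesgue (\<lambda>x. partial_deriv i \<phi> x * \<psi> x)"
    by (rule integrable_mult_test_function[OF continuous_imp_locally_integrable[OF
          test_functionD(5)[OF assms]] \<psi>])
  ultimately show "(LINT x|lebesgue. \<phi> x * partial_deriv i \<psi> x) = - (LINT x|lebesgue. partial_deriv i \<phi> x * \<psi> x)"
    by simp
qed

lemma test_function_in_D1p:
  assumes "test_function \<phi>" "p > 0"
  shows "\<phi> \<in> D1p p"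
proof -
  have "in_Lp p (partial_deriv i \<phi>)" for i
  proof -
    let ?g = "partial_deriv i \<phi>"
    note t = test_function_partial_deriv[OF assms(1), of i]
    obtain K where K: "compact K" "\<And>x. x \<notin> K \<Longrightarrow> ?g x = 0"
      using test_function_compact_support[OF t] by metis
    obtain B where B: "\<And>x. \<bar>?g x\<bar> \<le> B" using test_function_bounded[OF t] by blast
    have m: "?g \<in> borel_measurable lebesgue"
      using continuous_lebesgue_measurable test_functionD(2)[OF t] by blast
    \<comment> \<open>The constant 1 is the locally integrable factor; the power of the derivative
      is the bounded factor with compact support.\<close>
    have "integrable lebesgue (\<lambda>x. 1 * (\<bar>?g x\<bar> powr p))"
    proof (rule integrable_locally_integrable_mult[OF _ K(1)])
      show "\<bar>\<bar>?g x\<bar> powr p\<bar> \<le> B powr p" for x using B[of x] assms(2) by (simp add: powr_mono2)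
      show "locally_integrable (\<lambda>_::real^'a. 1 :: real)"
        by (rule continuous_imp_locally_integrable[OF continuous_on_const])
      show "(\<lambda>x. \<bar>?g x\<bar> powr p) \<in> borel_measurable lebesgue" using m by measurable
    qed (simp add: K(2))
    then show ?thesis using m by (simp add: in_Lp_def)
  qed
  then show ?thesis
    using weak_partial_deriv_test_function[OF assms(1)] test_functionD(2)[OF assms(1)]
      continuous_imp_locally_integrable[OF test_functionD(2)[OF assms(1)]]
    unfolding D1p_def by blast
qed

section \<open>The fundamental lemma of the calculus of variations\<close>

lemma integral_box_eq_0:
  assumes g: "locally_integrable g"
    and 0: "\<And>\<phi>. test_function \<phi> \<Longrightarrow> (LINT x|lebesgue. g x * \<phi> x) = 0"
  shows "(LINT x|lebesgue. g x * indicator (box a b) x) = 0"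
proof -
  have "(\<lambda>m. LINT x|lebesgue. g x * box_bump m a b x) \<longlonglongrightarrow> (LINT x|lebesgue. g x * indicator (box a b) x)"
  proof (rule integral_dominated_convergence)
    \<comment> \<open>The dominating function lives on the closed box, because local integrability
      is stated for compact sets.\<close>
    show "integrable lebesgue (\<lambda>x. indicator (cbox a b) x * \<bar>g x\<bar>)"
      using g[unfolded locally_integrable_def, rule_format, OF compact_cbox, of a b]
      by (auto dest: integrable_abs simp: set_integrable_def abs_mult)
    show "(\<lambda>x. g x * indicator (box a b) x) \<in> borel_measurable lebesgue"
      by (intro borel_measurable_times locally_integrable_measurable[OF g] borel_measurable_indicator) simp
    show "(\<lambda>x. g x * box_bump m a b x) \<in> borel_measurable lebesgue" for m
      using integrable_mult_test_function[OF g test_function_box_bump] by blast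
    show "AE x in lebesgue. (\<lambda>m. g x * box_bump m a b x) \<longlonglongrightarrow> g x * indicator (box a b) x"
      by (intro AE_I2 tendsto_intros box_bump_tendsto)
    show "AE x in lebesgue. norm (g x * box_bump m a b x) \<le> indicator (cbox a b) x * \<bar>g x\<bar>" for m
    proof (rule AE_I2)
      fix x
      show "norm (g x * box_bump m a b x) \<le> indicator (cbox a b) x * \<bar>g x\<bar>"
      proof (cases "x \<in> box a b")
        case True
        then have "x \<in> cbox a b" using box_subset_cbox by blast
        then show ?thesis
          using box_bump_bounds[of m a b x] by (simp add: abs_mult mult_left_le)
      qed (simp add: box_bump_outside)
    qed
  qed
  then show ?thesis
    using LIMSEQ_unique[OF _ tendsto_const] by (simp add: 0[OF test_function_box_bump])
qed

text \<open>A pi-lambda argument: boxes are stable under intersection and generate the Borel sets,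
  and vanishing of the integral passes to complements and to disjoint unions. The complement step is
  where the integral over the whole space enters.\<close>

lemma AE_eq_0_if_box_integrals_eq_0:
  fixes h :: "'a::euclidean_space \<Rightarrow> real"
  assumes h: "integrable lborel h" and h0: "(LINT x|lborel. h x) = 0"
    and box: "\<And>a b. (LINT x:box a b|lborel. h x) = 0"
  shows "AE x in lborel. h x = 0"
proof (rule sigma_finite_measure.density_zero[OF lborel.sigma_finite_measure_axioms h])
  fix A :: "'a set" assume "A \<in> sets lborel"
  let ?G = "range (\<lambda>(a, b). box a b :: 'a set)"
  have sets: "sigma_sets UNIV ?G = sets borel" by (simp add: borel_eq_box)
  have int: "set_integrable lborel B h" if "B \<in> sets borel" for B
    unfolding set_integrable_def by (rule integrable_mult_indicator) (use that h in auto)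
  have "Int_stable ?G" by (auto simp: Int_stable_def box_Int_box)
  moreover have "?G \<subseteq> Pow UNIV" by simp
  moreover have "A \<in> sigma_sets UNIV ?G" using \<open>A \<in> sets lborel\<close> by (simp add: sets)
  ultimately show "(LINT x:A|lborel. h x) = 0"
  proof (induction A rule: sigma_sets_induct_disjoint)
    case (compl B)
    then have "B \<in> sets borel" using sets by blast
    then have "(LINT x:(B \<union> (UNIV - B))|lborel. h x) = (LINT x:B|lborel. h x) + (LINT x:(UNIV - B)|lborel. h x)"
      by (intro set_integral_Un int) auto
    then show ?case using compl(2) h0 by (simp add: set_lebesgue_integral_def)
  next
    case (union B)
    then have B: "B i \<in> sets borel" for i using sets by blast
    then have "(LINT x:(\<Union>i. B i)|lborel. h x) = (\<Sum>i. LINT x:B i|lborel. h x)"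
      using union(1) by (intro lebesgue_integral_countable_add int) (auto simp: disjoint_family_on_def)
    then show ?case using union(3) by simp
  next
    case empty
    show ?case by (simp add: set_lebesgue_integral_def)
  qed (use box in auto)
qed

lemma fundamental_lemma_calculus_of_variations:
  fixes g :: "real^'n::finite \<Rightarrow> real"
  assumes g: "locally_integrable g"
    and 0: "\<And>\<phi>. test_function \<phi> \<Longrightarrow> (LINT x|lebesgue. g x * \<phi> x) = 0"
  shows "AE x in lebesgue. g x = 0"
proof -
  let ?B = "\<lambda>N. box (- (\<chi> i. real N)) (\<chi> i. real N) :: (real^'n) set"
  \<comment> \<open>The weak derivative is only Lebesgue measurable, while the box criterion is
    formulated over \<open>lborel\<close>; the Borel version \<open>h\<close> mediates.\<close>
  obtain h where h: "h \<in> borel_measurable lborel" "AE x in lborel. g x = h x"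
    using completion_ex_borel_measurable_real[OF locally_integrable_measurable[OF g]] by blast
  have AEh: "AE x in lebesgue. g x = h x" by (rule AE_completion[OF h(2)])
  have gi: "(\<lambda>x. g x * indicator (box a b) x) \<in> borel_measurable lebesgue" for a b
    by (intro borel_measurable_times locally_integrable_measurable[OF g] borel_measurable_indicator) simp
  have hi: "(\<lambda>x. h x * indicator (box a b) x) \<in> borel_measurable lebesgue" for a b
    by (intro borel_measurable_times measurable_completion[OF h(1)] borel_measurable_indicator) simp
  note [measurable] = h(1)
  have int_h: "(LINT x|lborel. h x * indicator (box a b) x) = 0" for a b
  proof -
    have "(LINT x|lborel. h x * indicator (box a b) x) = (LINT x|lebesgue. h x * indicator (box a b) x)"
      by (subst integral_completion) measurable
    also have "\<dots> = (LINT x|lebesgue. g x * indicator (box a b) x)"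
      by (rule integral_cong_AE) (use AEh hi gi in \<open>auto elim: eventually_mono\<close>)
    finally show ?thesis using integral_box_eq_0[OF g 0] by simp
  qed
  \<comment> \<open>Cutting off to a bounded box makes \<open>h\<close> globally integrable. The
    cut-off still has vanishing integrals over boxes, since two boxes meet in a box.\<close>
  have "AE x in lborel. h x * indicator (?B N) x = 0" for N
  proof (rule AE_eq_0_if_box_integrals_eq_0)
    have "integrable lebesgue (\<lambda>x. g x * indicator (?B N) x)"
    proof (rule integrable_locally_integrable_mult[OF g compact_cbox, where B = 1])
      show "indicat_real (?B N) \<in> borel_measurable lebesgue" by (intro borel_measurable_indicator) simp
      show "\<bar>indicat_real (?B N) x\<bar> \<le> 1" for x by (simp add: indicator_def)
      show "indicat_real (?B N) x = 0" if "x \<notin> cbox (- (\<chi> i. real N)) (\<chi> i. real N)" for x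
      proof -
        have "x \<notin> ?B N" using that box_subset_cbox by blast
        then show ?thesis by simp
      qed
    qed
    then have "integrable lebesgue (\<lambda>x. h x * indicator (?B N) x)"
      by (rule integrable_cong_AE_imp) (use AEh hi in \<open>auto elim: eventually_mono\<close>)
    then show "integrable lborel (\<lambda>x. h x * indicator (?B N) x)"
      by (subst (asm) integrable_completion) measurable
    show "(LINT x|lborel. h x * indicator (?B N) x) = 0" by (rule int_h)
    fix a b :: "real^'n"
    obtain c d where cd: "box a b \<inter> ?B N = box c d" using box_Int_box by blast
    have "indicator (box a b) x * indicator (?B N) x = (indicator (box c d) x :: real)" for x
      unfolding cd[symmetric] by (rule indicator_inter_arith[symmetric])
    then have "indicator (box a b) x *\<^sub>R (h x * indicator (?B N) x) = h x * indicator (box c d) x" for x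
      by (metis mult.left_commute real_scaleR_def)
    then show "(LINT x:box a b|lborel. h x * indicator (?B N) x) = 0"
      unfolding set_lebesgue_integral_def using int_h[of c d] by presburger
  qed
  then have "AE x in lborel. \<forall>N. h x * indicator (?B N) x = 0"
    unfolding AE_all_countable by blast
  then have "AE x in lborel. h x = 0"
  proof (rule eventually_mono)
    fix x assume x: "\<forall>N. h x * indicator (?B N) x = 0"
    obtain N :: nat where N: "norm x < real N" using reals_Archimedean2 by blast
    have "x \<in> ?B N"
    proof (clarsimp simp: mem_box_cart)
      fix i
      show "- real N < x $ i \<and> x $ i < real N" using component_le_norm_cart[of x i] N by linarith
    qed
    then show "h x = 0" using x by (metis indicator_simps(1) mult.right_neutral)
  qed
  from AE_completion[OF this] AEh show ?thesis by eventually_elim simp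
qed

lemma weak_partial_deriv_unique:
  assumes "weak_partial_deriv i u g" "weak_partial_deriv i u h"
  shows "AE x in lebesgue. g x = h x"
proof -
  have loc: "locally_integrable g" "locally_integrable h"
    using assms by (auto simp: weak_partial_deriv_def)
  have "AE x in lebesgue. g x - h x = 0"
  proof (rule fundamental_lemma_calculus_of_variations)
    show "locally_integrable (\<lambda>x. g x - h x)"
      using loc by (auto simp: locally_integrable_def intro: set_integral_diff)
    fix \<phi> :: "real^'a \<Rightarrow> real" assume \<phi>: "test_function \<phi>"
    show "(LINT x|lebesgue. (g x - h x) * \<phi> x) = 0"
      using assms \<phi> integrable_mult_test_function[OF loc(1) \<phi>] integrable_mult_test_function[OF loc(2) \<phi>]
      by (simp add: weak_partial_deriv_def left_diff_distrib)
  qed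
  then show ?thesis by simp
qed

section \<open>Continuous functions with vanishing weak gradient\<close>

lemma continuous_AE_eq_0:
  fixes f :: "real^'n::finite \<Rightarrow> real"
  assumes "continuous_on UNIV f" "AE x in lebesgue. f x = 0"
  shows "f x = 0"
proof (rule ccontr)
  assume "f x \<noteq> 0"
  have "open {x. f x \<noteq> 0}" using assms(1) by (intro open_Collect_neq continuous_on_const)
  moreover have "negligible {x. f x \<noteq> 0}"
    using assms(2) by (auto simp: negligible_iff_null_sets eventually_ae_filter
        intro: null_sets_completion_subset)
  ultimately show False using \<open>f x \<noteq> 0\<close> open_not_negligible by blast
qed

text \<open>For a test function \<phi>, the integral of \<open>u\<close> against \<phi> shifted by
  \<open>t\<close> along a coordinate axis has derivative 0 in \<open>t\<close>, since shifted test
  functions are again test functions. Moving the shift onto \<open>u\<close> shows that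
  \<open>u\<close> and its translate cannot be told apart by test functions, hence agree.\<close>

lemma continuous_weak_gradient_0_imp_const:
  fixes u :: "real^'n::finite \<Rightarrow> real"
  assumes u: "continuous_on UNIV u"
    and 0: "\<And>i \<phi>. test_function \<phi> \<Longrightarrow> (LINT x|lebesgue. u x * partial_deriv i \<phi> x) = 0"
  shows "u x = u 0"
proof -
  have shift: "u (y + s *\<^sub>R axis i 1) = u y" for y s i
  proof -
    let ?e = "axis i 1 :: real^'n"
    have cu: "continuous_on UNIV (\<lambda>x. u (x + a))" for a
      by (intro continuous_intros continuous_on_compose2[OF u]) auto
    have "AE x in lebesgue. u (x + s *\<^sub>R ?e) - u x = 0"
    proof (rule fundamental_lemma_calculus_of_variations)
      show "locally_integrable (\<lambda>x. u (x + s *\<^sub>R ?e) - u x)"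
        by (intro continuous_imp_locally_integrable continuous_intros cu u)
      fix \<phi> :: "real^'n \<Rightarrow> real" assume \<phi>: "test_function \<phi>"
      let ?F = "\<lambda>t. LINT x|lebesgue. u x * \<phi> (x + t *\<^sub>R ?e)"
      have "(?F has_real_derivative 0) (at t)" for t
      proof -
        have "(LINT x|lebesgue. u x * partial_deriv i \<phi> (x + t *\<^sub>R ?e)) = 0"
          using 0[OF test_function_translate[OF \<phi>], of i "t *\<^sub>R ?e"]
          by (simp add: partial_deriv_translate test_functionD(3)[OF \<phi>])
        then show ?thesis using has_real_derivative_integral_translate[OF u \<phi>, of i t] by simp
      qed
      \<comment> \<open>The sign comes from the change of variables: shifting \<open>u\<close> by
        \<open>s\<close> amounts to shifting \<phi> by \<open>- s\<close>.\<close>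
      then have "?F (- s) = ?F 0" by (intro DERIV_isconst_all) blast
      moreover have "(LINT x|lebesgue. u (x + s *\<^sub>R ?e) * \<phi> x) = ?F (- s)"
      proof -
        have "continuous_on UNIV (\<lambda>x. u x * \<phi> (x + (- s) *\<^sub>R ?e))"
          by (intro continuous_intros u continuous_on_compose2[OF test_functionD(2)[OF \<phi>]]) auto
        from integral_translate[OF this, of "s *\<^sub>R ?e"] show ?thesis by simp
      qed
      moreover have "integrable lebesgue (\<lambda>x. u (x + s *\<^sub>R ?e) * \<phi> x)" "integrable lebesgue (\<lambda>x. u x * \<phi> x)"
        using integrable_mult_test_function[OF continuous_imp_locally_integrable[OF cu] \<phi>]
          integrable_mult_test_function[OF continuous_imp_locally_integrable[OF u] \<phi>] by blast+
      ultimately show "(LINT x|lebesgue. (u (x + s *\<^sub>R ?e) - u x) * \<phi> x) = 0"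
        by (simp add: left_diff_distrib)
    qed
    then have "u (y + s *\<^sub>R ?e) - u y = 0"
      by (rule continuous_AE_eq_0[rotated]) (intro continuous_intros cu u)
    then show ?thesis by simp
  qed
  \<comment> \<open>The point is reached from the origin by moving along one axis at a time.\<close>
  have "u (\<Sum>i\<in>A. x $ i *\<^sub>R axis i 1) = u 0" if "finite A" for A
    using that by induction (simp_all add: shift add.commute[of "_ *\<^sub>R _"])
  from this[of UNIV] show ?thesis
    using basis_expansion[of x] by (simp add: scalar_mult_eq_scaleR)
qed

section \<open>Signed measures and their integrals\<close>

lemma signed_borel_measure_sums:
  assumes "signed_borel_measure \<rho>" "range A \<subseteq> sets borel" "disjoint_family (A :: nat \<Rightarrow> _)"
  shows "(\<lambda>i. \<rho> (A i)) sums \<rho> (\<Union>i. A i)"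
  using assms unfolding signed_borel_measure_def by blast

lemma signed_borel_measure_Un:
  assumes \<rho>: "signed_borel_measure \<rho>" and AB: "A \<in> sets borel" "B \<in> sets borel" "A \<inter> B = {}"
  shows "\<rho> (A \<union> B) = \<rho> A + \<rho> B"
proof -
  let ?C = "\<lambda>i::nat. if i = 0 then A else if i = 1 then B else {}"
  have \<rho>0: "\<rho> {} = 0" using \<rho> by (simp add: signed_borel_measure_def)
  have "(\<lambda>i. \<rho> (?C i)) sums \<rho> (\<Union>i. ?C i)"
    using AB by (intro signed_borel_measure_sums[OF \<rho>]) (auto simp: disjoint_family_on_def)
  moreover have "(\<Union>i. ?C i) = A \<union> B" by (auto split: if_splits)
  moreover have "(\<lambda>i. \<rho> (?C i)) sums (\<Sum>i\<in>{0, 1}. \<rho> (?C i))"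
    by (rule sums_finite) (auto simp: \<rho>0)
  ultimately show ?thesis using sums_unique2 by fastforce
qed

lemma signed_borel_measure_Diff:
  assumes "signed_borel_measure \<rho>" "A \<in> sets borel" "B \<in> sets borel" "B \<subseteq> A"
  shows "\<rho> (A - B) = \<rho> A - \<rho> B"
  using signed_borel_measure_Un[OF assms(1) assms(3), of "A - B"] assms by (simp add: Un_absorb1)

text \<open>If \<open>\<rho>\<close> were unbounded, one could peel off infinitely many disjoint sets of mass at least 1 in
  absolute value, each time keeping a remainder on which \<open>\<rho>\<close> is unbounded.\<close>

lemma signed_borel_measure_bounded:
  fixes \<rho> :: "(real^'n::finite) set \<Rightarrow> real"
  assumes \<rho>: "signed_borel_measure \<rho>"
  obtains M where "\<And>A. A \<in> sets borel \<Longrightarrow> \<bar>\<rho> A\<bar> \<le> M"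
proof (rule ccontr)
  define unb where "unb A \<longleftrightarrow> A \<in> sets borel \<and> (\<forall>M. \<exists>B\<in>sets borel. B \<subseteq> A \<and> \<bar>\<rho> B\<bar> > M)" for A
  assume "\<not> thesis"
  then have "unb UNIV" unfolding unb_def using that by (metis not_less sets.top space_borel subset_UNIV)
  have unb_split: "unb B \<or> unb (A - B)" if A: "unb A" and B: "B \<in> sets borel" "B \<subseteq> A" for A B
  proof (rule ccontr)
    assume "\<not> ?thesis"
    moreover have "A - B \<in> sets borel" using A B by (auto simp: unb_def)
    ultimately obtain M1 M2 where M: "\<And>C. C \<in> sets borel \<Longrightarrow> C \<subseteq> B \<Longrightarrow> \<bar>\<rho> C\<bar> \<le> M1"
      "\<And>C. C \<in> sets borel \<Longrightarrow> C \<subseteq> A - B \<Longrightarrow> \<bar>\<rho> C\<bar> \<le> M2"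
      using B unfolding unb_def by (meson not_less)
    obtain C where C: "C \<in> sets borel" "C \<subseteq> A" "\<bar>\<rho> C\<bar> > M1 + M2" using A unfolding unb_def by blast
    have "\<rho> ((C \<inter> B) \<union> (C - B)) = \<rho> (C \<inter> B) + \<rho> (C - B)"
      by (rule signed_borel_measure_Un[OF \<rho>]) (use C B in auto)
    moreover have "(C \<inter> B) \<union> (C - B) = C" by blast
    moreover have "\<bar>\<rho> (C \<inter> B)\<bar> \<le> M1" "\<bar>\<rho> (C - B)\<bar> \<le> M2" using C B by (auto intro!: M)
    ultimately show False using C(3) by simp
  qed
  have step: "\<exists>B. unb B \<and> B \<subseteq> A \<and> 1 \<le> \<bar>\<rho> (A - B)\<bar>" if A: "unb A" for A
  proof -
    \<comment> \<open>The threshold gives both \<open>B\<close> and \<open>A - B\<close> mass at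
      least 1 in absolute value. Whichever of the two is unbounded can thus be kept, and the other
      one is peeled off.\<close>
    obtain B where B: "B \<in> sets borel" "B \<subseteq> A" "\<bar>\<rho> B\<bar> > \<bar>\<rho> A\<bar> + 1" using A unfolding unb_def by blast
    have "\<rho> (A - B) = \<rho> A - \<rho> B" using signed_borel_measure_Diff[OF \<rho> _ B(1,2)] A by (simp add: unb_def)
    then have "\<bar>\<rho> (A - B)\<bar> \<ge> 1" using B(3) by linarith
    moreover have "A - (A - B) = B" using B by blast
    moreover have "1 \<le> \<bar>\<rho> B\<bar>" using B(3) by linarith
    ultimately show ?thesis using unb_split[OF A B(1,2)] B(2) by (metis Diff_subset)
  qed
  then obtain nxt where nxt: "\<And>A. unb A \<Longrightarrow> unb (nxt A) \<and> nxt A \<subseteq> A \<and> 1 \<le> \<bar>\<rho> (A - nxt A)\<bar>"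
    by metis
  define R where "R = rec_nat UNIV (\<lambda>_. nxt)"
  have R_Suc: "R (Suc n) = nxt (R n)" for n by (simp add: R_def)
  have R: "unb (R n)" for n
    by (induction n) (use \<open>unb UNIV\<close> nxt in \<open>auto simp: R_def\<close>)
  have dec: "R n \<subseteq> R m" if "m \<le> n" for m n
    using that by (induction rule: dec_induct) (use R nxt R_Suc in fastforce)+
  \<comment> \<open>The peeled pieces are disjoint, so countable additivity forces their masses to
    0, against the lower bound 1.\<close>
  let ?D = "\<lambda>n. R n - R (Suc n)"
  have "disjoint_family ?D"
    unfolding disjoint_family_on_def
  proof (intro ballI impI)
    fix m n :: nat assume "m \<noteq> n"
    then consider "Suc m \<le> n" | "Suc n \<le> m" by linarith
    then show "?D m \<inter> ?D n = {}" using dec by cases blast+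
  qed
  moreover have "range ?D \<subseteq> sets borel" using R by (auto simp: unb_def)
  ultimately have "(\<lambda>n. \<rho> (?D n)) sums \<rho> (\<Union>n. ?D n)" by (intro signed_borel_measure_sums[OF \<rho>])
  then have "(\<lambda>n. \<rho> (?D n)) \<longlonglongrightarrow> 0" by (intro summable_LIMSEQ_zero sums_summable)
  then have "eventually (\<lambda>n. \<bar>\<rho> (?D n)\<bar> < 1) sequentially"
    using order_tendstoD(2)[OF tendsto_rabs_zero, of _ _ 1] by simp
  then obtain n where "\<bar>\<rho> (?D n)\<bar> < 1" by (auto simp: eventually_sequentially)
  then show False using nxt[OF R[of n]] R_Suc by (metis not_less)
qed

section \<open>The Jordan parts as finite measures on a compact set\<close>

lemma sets_jordan_pos [simp, measurable_cong]: "sets (jordan_pos \<rho>) = sets borel"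
  unfolding jordan_pos_def by (subst sets_measure_of) (auto simp: sets.sigma_sets_eq[of borel, simplified])

lemma space_jordan_pos [simp]: "space (jordan_pos \<rho>) = UNIV"
  unfolding jordan_pos_def by (subst space_measure_of) auto

text \<open>An inequality only: \<^const>\<open>measure_of\<close> yields the zero measure if the supremum is not countably
  additive, and this case need not be excluded here.\<close>

lemma emeasure_jordan_pos_le:
  "emeasure (jordan_pos \<rho>) A \<le> (SUP B \<in> {B \<in> sets borel. B \<subseteq> A}. ennreal (\<rho> B))"
  unfolding jordan_pos_def by (simp add: emeasure_measure_of_conv)

text \<open>In contrast to the support, the carrier \<open>K\<close> need not be the smallest one. A
  push forward is then carried simply by the image of \<open>K\<close>, without any computation of
  its support.\<close>

definition concentrated_on :: "((real^'n::finite) set \<Rightarrow> real) \<Rightarrow> (real^'n) set \<Rightarrow> bool" where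
  "concentrated_on \<rho> K \<longleftrightarrow> (\<forall>B\<in>sets borel. B \<inter> K = {} \<longrightarrow> \<rho> B = 0)"

lemma finite_measure_jordan_pos:
  assumes "signed_borel_measure \<rho>"
  shows "finite_measure (jordan_pos \<rho>)"
proof
  obtain M where "\<And>A. A \<in> sets borel \<Longrightarrow> \<bar>\<rho> A\<bar> \<le> M"
    using signed_borel_measure_bounded[OF assms] by blast
  then have "(SUP B \<in> {B \<in> sets borel. B \<subseteq> UNIV}. ennreal (\<rho> B)) \<le> ennreal M"
    by (intro SUP_least ennreal_leI) (auto dest: abs_le_D1)
  with emeasure_jordan_pos_le[of \<rho> UNIV] have "emeasure (jordan_pos \<rho>) UNIV \<le> ennreal M"
    by (rule order_trans)
  then show "emeasure (jordan_pos \<rho>) (space (jordan_pos \<rho>)) \<noteq> \<infinity>"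
    by (auto simp: top_unique)
qed

lemma AE_jordan_pos:
  assumes "concentrated_on \<rho> K" "compact K"
  shows "AE x in jordan_pos \<rho>. x \<in> K"
proof (rule AE_I)
  have "(SUP B \<in> {B \<in> sets borel. B \<subseteq> - K}. ennreal (\<rho> B)) \<le> 0"
    using assms(1) by (intro SUP_least) (auto simp: concentrated_on_def)
  with emeasure_jordan_pos_le[of \<rho> "- K"] have "emeasure (jordan_pos \<rho>) (- K) \<le> 0"
    by (rule order_trans)
  then show "emeasure (jordan_pos \<rho>) (- K) = 0" by simp
  show "- K \<in> sets (jordan_pos \<rho>)" using compact_imp_closed[OF assms(2)] by simp
qed auto

lemma signed_borel_measure_uminus:
  "signed_borel_measure \<rho> \<Longrightarrow> signed_borel_measure (\<lambda>A. - \<rho> A)"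
  unfolding signed_borel_measure_def by (auto intro: sums_minus)

lemma concentrated_on_uminus: "concentrated_on \<rho> K \<Longrightarrow> concentrated_on (\<lambda>A. - \<rho> A) K"
  by (simp add: concentrated_on_def)

lemma integrable_jordan_pos:
  fixes f :: "real^'n::finite \<Rightarrow> 'b::{banach, second_countable_topology}"
  assumes \<rho>: "signed_borel_measure \<rho>" and K: "concentrated_on \<rho> K" "compact K"
    and f: "continuous_on UNIV f"
  shows "integrable (jordan_pos \<rho>) f"
proof -
  have "compact (f ` K)" using K(2) f by (meson compact_continuous_image continuous_on_subset subset_UNIV)
  then obtain B where B: "\<And>y. y \<in> f ` K \<Longrightarrow> norm y \<le> B" using compact_imp_bounded bounded_iff by metis
  have "f \<in> borel_measurable (jordan_pos \<rho>)"
    using borel_measurable_continuous_onI[OF f] measurable_cong_sets[OF sets_jordan_pos refl] by blast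
  moreover have "AE x in jordan_pos \<rho>. norm (f x) \<le> B"
    using AE_jordan_pos[OF K] by (rule eventually_mono) (use B in auto)
  ultimately show ?thesis by (intro finite_measure.integrable_const_bound[OF finite_measure_jordan_pos[OF \<rho>]])
qed

lemma signed_integral_add:
  assumes "signed_borel_measure \<rho>" "concentrated_on \<rho> K" "compact K"
    and "continuous_on UNIV f" "continuous_on UNIV g"
  shows "signed_integral \<rho> (\<lambda>x. f x + g x) = signed_integral \<rho> f + signed_integral \<rho> g"
proof -
  note int = integrable_jordan_pos[OF assms(1-3)]
    integrable_jordan_pos[OF signed_borel_measure_uminus[OF assms(1)]
      concentrated_on_uminus[OF assms(2)] assms(3)]
  show ?thesis unfolding signed_integral_def by (simp add: int assms)
qed

text \<open>Dominated convergence for both Jordan parts, shaped for truncations of \<open>g\<close>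
  by bumps: these never exceed \<open>g\<close> in absolute value and need to converge only where
  the measure lives.\<close>

lemma signed_integral_tendsto:
  fixes f :: "nat \<Rightarrow> real^'n::finite \<Rightarrow> real"
  assumes \<rho>: "signed_borel_measure \<rho>" and K: "concentrated_on \<rho> K" "compact K"
    and cont: "\<And>m. continuous_on UNIV (f m)" "continuous_on UNIV g"
    and lim: "\<And>x. x \<in> K \<Longrightarrow> (\<lambda>m. f m x) \<longlonglongrightarrow> g x"
    and bound: "\<And>m x. \<bar>f m x\<bar> \<le> \<bar>g x\<bar>"
  shows "(\<lambda>m. signed_integral \<rho> (f m)) \<longlonglongrightarrow> signed_integral \<rho> g"
proof -
  have *: "(\<lambda>m. LINT x|jordan_pos \<sigma>. f m x) \<longlonglongrightarrow> (LINT x|jordan_pos \<sigma>. g x)"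
    if "signed_borel_measure \<sigma>" "concentrated_on \<sigma> K" for \<sigma>
  proof (rule integral_dominated_convergence)
    have g: "integrable (jordan_pos \<sigma>) g" by (rule integrable_jordan_pos[OF that K(2) cont(2)])
    then show "integrable (jordan_pos \<sigma>) (\<lambda>x. \<bar>g x\<bar>)" "g \<in> borel_measurable (jordan_pos \<sigma>)" by auto
    show "f m \<in> borel_measurable (jordan_pos \<sigma>)" for m
      using integrable_jordan_pos[OF that K(2) cont(1)] by blast
    show "AE x in jordan_pos \<sigma>. (\<lambda>m. f m x) \<longlonglongrightarrow> g x"
      using AE_jordan_pos[OF that(2) K(2)] by (rule eventually_mono) (rule lim)
  qed (use bound in auto)
  show ?thesis
    unfolding signed_integral_def
    by (intro tendsto_diff * \<rho> K signed_borel_measure_uminus concentrated_on_uminus)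
qed

text \<open>Every point off the support has an open neighbourhood all of whose Borel subsets have
  mass 0. Countably many of these cover \<open>B\<close>, and cutting \<open>B\<close> along the
  disjointed cover leaves only pieces of mass 0.\<close>

lemma concentrated_on_signed_support:
  fixes \<rho> :: "(real^'n::finite) set \<Rightarrow> real"
  assumes \<rho>: "signed_borel_measure \<rho>"
  shows "concentrated_on \<rho> (signed_support \<rho>)"
  unfolding concentrated_on_def
proof (intro ballI impI)
  fix B :: "(real^'n) set" assume B: "B \<in> sets borel" "B \<inter> signed_support \<rho> = {}"
  let ?F = "{U. open U \<and> (\<forall>A\<in>sets borel. A \<subseteq> U \<longrightarrow> \<rho> A = 0)}"
  have cover: "B \<subseteq> \<Union>?F"
  proof
    fix x assume "x \<in> B"
    then have "x \<notin> signed_support \<rho>" using B(2) by blast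
    then show "x \<in> \<Union>?F" unfolding signed_support_def by blast
  qed
  \<comment> \<open>The Lindelof property brings the cover within reach of countable
    additivity.\<close>
  obtain F' where F': "F' \<subseteq> ?F" "countable F'" "\<Union>F' = \<Union>?F" using Lindelof[of ?F] by blast
  show "\<rho> B = 0"
  proof (cases "F' = {}")
    case True
    then have "B = {}" using cover F'(3) by auto
    then show ?thesis using \<rho> by (simp add: signed_borel_measure_def)
  next
    case False
    let ?U = "from_nat_into F'"
    let ?D = "\<lambda>n. B \<inter> disjointed ?U n"
    have U: "?U n \<in> ?F" for n using F'(1) from_nat_into[OF False] by blast
    have "\<Union>F' = (\<Union>n. ?U n)" using range_from_nat_into[OF False F'(2)] by simp
    then have "B \<subseteq> (\<Union>n. disjointed ?U n)" using cover F'(3) by (simp add: UN_disjointed_eq)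
    then have B_eq: "B = (\<Union>n. ?D n)" by blast
    have D: "?D n \<in> sets borel" for n
    proof -
      have "range ?U \<subseteq> sets borel" using U by (auto intro: borel_open)
      then have "disjointed ?U n \<in> sets borel" using sets.range_disjointed_sets by blast
      then show ?thesis using B(1) by blast
    qed
    have "(\<lambda>n. \<rho> (?D n)) sums \<rho> (\<Union>n. ?D n)"
      using D disjoint_family_disjointed[of ?U]
      by (intro signed_borel_measure_sums[OF \<rho>]) (auto simp: disjoint_family_on_def)
    moreover have "\<rho> (?D n) = 0" for n
      using U[of n] D[of n] disjointed_subset[of ?U n] by blast
    ultimately show ?thesis using B_eq sums_unique2[OF _ sums_zero] by simp
  qed
qed

lemma signed_borel_measure_push_forward:
  assumes \<rho>: "signed_borel_measure \<rho>" and S: "S \<in> borel_measurable borel"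
  shows "signed_borel_measure (push_forward S \<rho>)"
  unfolding signed_borel_measure_def
proof (intro conjI allI impI)
  show "push_forward S \<rho> {} = 0" using \<rho> by (simp add: push_forward_def signed_borel_measure_def)
  fix A :: "nat \<Rightarrow> (real^'a) set" assume A: "range A \<subseteq> sets borel" "disjoint_family A"
  have "(\<lambda>i. \<rho> (S -` A i)) sums \<rho> (\<Union>i. S -` A i)"
    using A measurable_sets[OF S] by (intro signed_borel_measure_sums[OF \<rho>]) (auto simp: disjoint_family_on_def)
  then show "(\<lambda>i. push_forward S \<rho> (A i)) sums push_forward S \<rho> (\<Union>i. A i)"
    by (simp add: push_forward_def vimage_UN)
qed

lemma concentrated_on_push_forward:
  assumes "concentrated_on \<rho> K" "S \<in> borel_measurable borel"
  shows "concentrated_on (push_forward S \<rho>) (S ` K)"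
  unfolding concentrated_on_def push_forward_def
proof (intro ballI impI)
  fix B :: "(real^'a) set" assume B: "B \<in> sets borel" "B \<inter> S ` K = {}"
  have "S -` B \<in> sets borel" using measurable_sets[OF assms(2) B(1)] by simp
  moreover have "S -` B \<inter> K = {}" using B(2) by blast
  ultimately show "\<rho> (S -` B) = 0" using assms(1) by (simp add: concentrated_on_def)
qed

lemma continuous_on_similarity:
  assumes "S \<in> similarities"
  shows "continuous_on UNIV S"
  using assms unfolding similarities_def
  by (auto intro!: continuous_on_add continuous_on_scaleR continuous_on_const
      matrix_vector_mult_linear_continuous_on)

section \<open>Strict convexity and weak gradients\<close>

text \<open>The mean value theorem on the two halves of the interval compares increments through the
  strictly increasing derivative. Differentiability is used only in the interior, so the left end
  may be 0.\<close>

lemma powr_midpoint_strict: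
  fixes p s t :: real
  assumes p: "1 < p" and st: "0 \<le> s" "s < t"
  shows "((s + t) / 2) powr p < (s powr p + t powr p) / 2"
proof -
  let ?m = "(s + t) / 2"
  have mvt: "\<exists>z. a < z \<and> z < b \<and> b powr p - a powr p = (b - a) * (p * z powr (p - 1))"
    if ab: "0 \<le> a" "a < b" for a b :: real
  proof -
    have d: "((\<lambda>x. x powr p) has_real_derivative p * x powr (p - 1)) (at x)" if "a < x" for x
      using that ab by (intro has_real_derivative_powr) auto
    have "continuous_on {a..b} (\<lambda>x. x powr p)"
      using ab p by (intro continuous_on_powr' continuous_intros) auto
    then obtain l z where z: "a < z" "z < b" "((\<lambda>x. x powr p) has_real_derivative l) (at z)"
        "b powr p - a powr p = (b - a) * l"
      using MVT[of a b "\<lambda>x. x powr p"] ab(2) d by (metis real_differentiable_def)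
    then show ?thesis using DERIV_unique[OF z(3) d[OF z(1)]] by blast
  qed
  obtain y where y: "s < y" "y < ?m" "?m powr p - s powr p = (?m - s) * (p * y powr (p - 1))"
    using mvt[of s ?m] st by auto
  obtain z where z: "?m < z" "z < t" "t powr p - ?m powr p = (t - ?m) * (p * z powr (p - 1))"
    using mvt[of ?m t] st by auto
  have "y powr (p - 1) < z powr (p - 1)"
    using p st y z by (intro powr_less_mono2) auto
  then have "(?m - s) * (p * y powr (p - 1)) < (?m - s) * (p * z powr (p - 1))"
    using p st by (intro mult_strict_left_mono) auto
  also have "\<dots> = (t - ?m) * (p * z powr (p - 1))"
    by (simp add: field_simps)
  finally show ?thesis using y(3) z(3) by simp
qed

lemma powr_midpoint_le:
  fixes p s t :: real
  assumes "1 < p" "0 \<le> s" "0 \<le> t"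
  shows "((s + t) / 2) powr p \<le> (s powr p + t powr p) / 2"
    and "s \<noteq> t \<Longrightarrow> ((s + t) / 2) powr p < (s powr p + t powr p) / 2"
  using powr_midpoint_strict[of p s t] powr_midpoint_strict[of p t s] assms
  by (cases s t rule: linorder_cases; simp add: add.commute)+

text \<open>Strictness has two sources. If the norms differ, it is the strict convexity of the
  scalar power; if they agree, the parallelogram law makes the midpoint strictly shorter.\<close>

lemma norm_powr_midpoint_le:
  fixes a b :: "'a::real_inner"
  assumes p: "1 < p"
  shows "norm ((1/2) *\<^sub>R (a + b)) powr p \<le> (norm a powr p + norm b powr p) / 2"
    and "a \<noteq> b \<Longrightarrow> norm ((1/2) *\<^sub>R (a + b)) powr p < (norm a powr p + norm b powr p) / 2"
proof -
  have le: "norm ((1/2) *\<^sub>R (a + b)) \<le> (norm a + norm b) / 2"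
    using norm_triangle_ineq[of a b] by simp
  then have le_p: "norm ((1/2) *\<^sub>R (a + b)) powr p \<le> ((norm a + norm b) / 2) powr p"
    using p by (intro powr_mono2) auto
  then show "norm ((1/2) *\<^sub>R (a + b)) powr p \<le> (norm a powr p + norm b powr p) / 2"
    using powr_midpoint_le(1)[OF p norm_ge_zero norm_ge_zero, of a b] by linarith
  assume "a \<noteq> b"
  show "norm ((1/2) *\<^sub>R (a + b)) powr p < (norm a powr p + norm b powr p) / 2"
  proof (cases "norm a = norm b")
    case False
    then show ?thesis
      using le_p powr_midpoint_le(2)[OF p norm_ge_zero norm_ge_zero, of a b] by linarith
  next
    case True
    have "(norm (a + b))\<^sup>2 + (norm (a - b))\<^sup>2 = 2 * (norm a)\<^sup>2 + 2 * (norm b)\<^sup>2"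
      by (simp add: power2_norm_eq_inner algebra_simps inner_commute)
    then have "(norm (a + b))\<^sup>2 + (norm (a - b))\<^sup>2 = (2 * norm b)\<^sup>2"
      using True by (simp add: power_mult_distrib)
    moreover have "(norm (a - b))\<^sup>2 > 0" using \<open>a \<noteq> b\<close> by simp
    ultimately have "(norm (a + b))\<^sup>2 < (2 * norm b)\<^sup>2" by linarith
    then have "norm (a + b) < 2 * norm b" by (rule power2_less_imp_less) simp
    then have "norm ((1/2) *\<^sub>R (a + b)) < norm b" by simp
    then have "norm ((1/2) *\<^sub>R (a + b)) powr p < norm b powr p"
      using p by (intro powr_less_mono2) auto
    then show ?thesis using True by simp
  qed
qed

lemma integrable_norm_powr_midpoint:
  fixes f g :: "'a \<Rightarrow> 'b::euclidean_space"
  assumes p: "1 < p" and [measurable]: "f \<in> borel_measurable M" "g \<in> borel_measurable M"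
    and int: "integrable M (\<lambda>x. norm (f x) powr p)" "integrable M (\<lambda>x. norm (g x) powr p)"
  shows "integrable M (\<lambda>x. norm ((1/2) *\<^sub>R (f x + g x)) powr p)"
proof (rule Bochner_Integration.integrable_bound)
  show "integrable M (\<lambda>x. (norm (f x) powr p + norm (g x) powr p) / 2)" using int by simp
  show "AE x in M. norm (norm ((1/2) *\<^sub>R (f x + g x)) powr p) \<le> norm ((norm (f x) powr p + norm (g x) powr p) / 2)"
    using norm_powr_midpoint_le(1)[OF p] by (intro AE_I2) simp
qed measurable

text \<open>The pointwise convexity defect is nonnegative while the hypotheses make its integral
  nonpositive. It therefore vanishes almost everywhere, and strict convexity turns this into
  equality of the values.\<close>

lemma AE_eq_if_Lp_midpoint:
  fixes f g :: "'a \<Rightarrow> 'b::euclidean_space"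
  assumes p: "1 < p" and meas: "f \<in> borel_measurable M" "g \<in> borel_measurable M"
    and int: "integrable M (\<lambda>x. norm (f x) powr p)" "integrable M (\<lambda>x. norm (g x) powr p)"
    and eq: "(LINT x|M. norm (f x) powr p) = (LINT x|M. norm (g x) powr p)"
    and le: "(LINT x|M. norm (f x) powr p) \<le> (LINT x|M. norm ((1/2) *\<^sub>R (f x + g x)) powr p)"
  shows "AE x in M. f x = g x"
proof -
  note int_mid = integrable_norm_powr_midpoint[OF p meas int]
  let ?d = "\<lambda>x. (norm (f x) powr p + norm (g x) powr p) / 2 - norm ((1/2) *\<^sub>R (f x + g x)) powr p"
  have nonneg: "0 \<le> ?d x" for x using norm_powr_midpoint_le(1)[OF p, of "f x" "g x"] by linarith
  have d: "integrable M ?d" using int int_mid by simp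
  have "(LINT x|M. ?d x) = (LINT x|M. norm (f x) powr p) - (LINT x|M. norm ((1/2) *\<^sub>R (f x + g x)) powr p)"
    using int int_mid eq by simp
  then have "(LINT x|M. ?d x) \<le> 0" using le by linarith
  moreover have "(LINT x|M. ?d x) \<ge> 0" by (rule integral_nonneg_AE[OF AE_I2]) (rule nonneg)
  ultimately have "AE x in M. ?d x = 0"
    using integral_nonneg_eq_0_iff_AE[OF d AE_I2[OF nonneg]] by linarith
  then show ?thesis
  proof (rule eventually_mono)
    fix x assume "?d x = 0"
    then show "f x = g x" using norm_powr_midpoint_le(2)[OF p, of "f x" "g x"] by linarith
  qed
qed

section \<open>The chosen weak gradient, and midpoints in D^{1,p}\<close>

lemma norm_powr_le_sum_powr:
  fixes x :: "real^'n::finite"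
  assumes p: "0 < p"
  shows "norm x powr p \<le> real CARD('n) powr p * (\<Sum>i\<in>UNIV. \<bar>x $ i\<bar> powr p)"
proof -
  \<comment> \<open>Bounding all coordinates by a largest one produces the crude constant
    \<open>real CARD('n) powr p\<close>, enough to pass from components in L^p to the Euclidean
    norm.\<close>
  obtain j where j: "\<And>i. \<bar>x $ i\<bar> \<le> \<bar>x $ j\<bar>"
    using Max_in[of "range (\<lambda>i. \<bar>x $ i\<bar>)"] Max_ge[of "range (\<lambda>i. \<bar>x $ i\<bar>)"] by fastforce
  have "norm x \<le> (\<Sum>i\<in>UNIV. \<bar>x $ i\<bar>)" by (rule norm_le_l1_cart)
  also have "\<dots> \<le> real CARD('n) * \<bar>x $ j\<bar>" using sum_bounded_above[of UNIV "\<lambda>i. \<bar>x $ i\<bar>"] j by simp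
  finally have "norm x powr p \<le> (real CARD('n) * \<bar>x $ j\<bar>) powr p" using p by (intro powr_mono2) auto
  also have "\<dots> = real CARD('n) powr p * \<bar>x $ j\<bar> powr p" by (simp add: powr_mult)
  also have "\<bar>x $ j\<bar> powr p \<le> (\<Sum>i\<in>UNIV. \<bar>x $ i\<bar> powr p)" by (rule member_le_sum) auto
  finally show ?thesis by (simp add: mult_left_mono)
qed

lemma borel_measurable_vec_components:
  fixes f :: "'a \<Rightarrow> real^'n::finite"
  assumes "\<And>i. (\<lambda>x. f x $ i) \<in> borel_measurable M"
  shows "f \<in> borel_measurable M"
  using assms by (subst borel_measurable_euclidean_space) (auto simp: Basis_vec_def inner_axis)

text \<open>The choice behind \<open>weak_grad\<close> asks for weak derivatives but not for
  integrability; that is inherited almost everywhere from the witnesses in \<open>D1p\<close>. It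
  matters because the integral defining \<open>grad_norm\<close> would default to 0
  otherwise.\<close>

lemma weak_grad:
  fixes u :: "real^'n::finite \<Rightarrow> real"
  assumes u: "u \<in> D1p p" and p: "0 < p"
  shows weak_partial_deriv_weak_grad: "weak_partial_deriv i u (\<lambda>x. weak_grad u x $ i)"
    and in_Lp_weak_grad: "in_Lp p (\<lambda>x. weak_grad u x $ i)"
    and measurable_weak_grad: "weak_grad u \<in> borel_measurable lebesgue"
    and integrable_weak_grad: "integrable lebesgue (\<lambda>x. norm (weak_grad u x) powr p)"
proof -
  obtain g where g: "\<And>i. weak_partial_deriv i u (g i)" "\<And>i. in_Lp p (g i)"
    using u unfolding D1p_def by (auto; metis)
  have "\<exists>G. \<forall>i. weak_partial_deriv i u (\<lambda>x. G x $ i)"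
    by (rule exI[of _ "\<lambda>x. \<chi> i. g i x"]) (simp add: g(1))
  then have "\<forall>i. weak_partial_deriv i u (\<lambda>x. weak_grad u x $ i)"
    unfolding weak_grad_def by (rule someI_ex)
  then show G: "weak_partial_deriv i u (\<lambda>x. weak_grad u x $ i)" for i by blast
  have meas: "(\<lambda>x. weak_grad u x $ i) \<in> borel_measurable lebesgue" for i
    using G[of i] by (intro locally_integrable_measurable) (simp add: weak_partial_deriv_def)
  then show m: "weak_grad u \<in> borel_measurable lebesgue" by (rule borel_measurable_vec_components)
  have int: "integrable lebesgue (\<lambda>x. \<bar>weak_grad u x $ i\<bar> powr p)" for i
  proof (rule integrable_cong_AE_imp)
    show "integrable lebesgue (\<lambda>x. \<bar>g i x\<bar> powr p)" using g(2) by (simp add: in_Lp_def)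
    show "(\<lambda>x. \<bar>weak_grad u x $ i\<bar> powr p) \<in> borel_measurable lebesgue" using meas[of i] by measurable
    show "AE x in lebesgue. \<bar>g i x\<bar> powr p = \<bar>weak_grad u x $ i\<bar> powr p"
      using weak_partial_deriv_unique[OF g(1) G[of i]] by (rule eventually_mono) simp
  qed
  then show "in_Lp p (\<lambda>x. weak_grad u x $ i)" for i using meas by (simp add: in_Lp_def)
  show "integrable lebesgue (\<lambda>x. norm (weak_grad u x) powr p)"
  proof (rule Bochner_Integration.integrable_bound)
    show "integrable lebesgue (\<lambda>x. real CARD('n) powr p * (\<Sum>i\<in>UNIV. \<bar>weak_grad u x $ i\<bar> powr p))"
      using int by simp
    show "(\<lambda>x. norm (weak_grad u x) powr p) \<in> borel_measurable lebesgue" using m by measurable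
    show "AE x in lebesgue. norm (norm (weak_grad u x) powr p)
        \<le> norm (real CARD('n) powr p * (\<Sum>i\<in>UNIV. \<bar>weak_grad u x $ i\<bar> powr p))"
      using norm_powr_le_sum_powr[OF p] by (intro AE_I2) (simp add: sum_nonneg)
  qed
qed

lemma weak_partial_deriv_midpoint:
  assumes "weak_partial_deriv i u g" "weak_partial_deriv i v h"
    and "locally_integrable u" "locally_integrable v"
  shows "weak_partial_deriv i (\<lambda>x. (1/2) * (u x + v x)) (\<lambda>x. (1/2) * (g x + h x))"
  unfolding weak_partial_deriv_def
proof (intro conjI allI impI)
  have gh: "locally_integrable g" "locally_integrable h" using assms by (auto simp: weak_partial_deriv_def)
  then show "locally_integrable (\<lambda>x. (1/2) * (g x + h x))"
    by (auto simp: locally_integrable_def intro: set_integral_add)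
  fix \<phi> :: "real^'a \<Rightarrow> real" assume \<phi>: "test_function \<phi>"
  note int = assms(3,4)[THEN integrable_mult_test_function[OF _ test_function_partial_deriv[OF \<phi>, of i]]]
    gh[THEN integrable_mult_test_function[OF _ \<phi>]]
  have "(LINT x|lebesgue. (1/2) * (u x + v x) * partial_deriv i \<phi> x)
      = (1/2) * ((LINT x|lebesgue. u x * partial_deriv i \<phi> x) + (LINT x|lebesgue. v x * partial_deriv i \<phi> x))"
    using int by (simp add: distrib_right mult.assoc)
  also have "\<dots> = - ((1/2) * ((LINT x|lebesgue. g x * \<phi> x) + (LINT x|lebesgue. h x * \<phi> x)))"
    using assms(1,2) \<phi> by (simp add: weak_partial_deriv_def algebra_simps)
  also have "\<dots> = - (LINT x|lebesgue. (1/2) * (g x + h x) * \<phi> x)"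
    using int by (simp add: distrib_right mult.assoc)
  finally show "(LINT x|lebesgue. (1/2) * (u x + v x) * partial_deriv i \<phi> x)
      = - (LINT x|lebesgue. (1/2) * (g x + h x) * \<phi> x)" .
qed

lemma D1p_midpoint:
  assumes p: "1 < p" and u: "u \<in> D1p p" and v: "v \<in> D1p p"
  shows "(\<lambda>x. (1/2) * (u x + v x)) \<in> D1p p"
    and "AE x in lebesgue. weak_grad (\<lambda>x. (1/2) * (u x + v x)) x = (1/2) *\<^sub>R (weak_grad u x + weak_grad v x)"
proof -
  let ?w = "\<lambda>x. (1/2) * (u x + v x)"
  have p0: "0 < p" using p by simp
  have wd: "weak_partial_deriv i ?w (\<lambda>x. (1/2) * (weak_grad u x $ i + weak_grad v x $ i))" for i
    using u v by (intro weak_partial_deriv_midpoint weak_partial_deriv_weak_grad[OF _ p0]) (auto simp: D1p_def)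
  have Lp: "in_Lp p (\<lambda>x. (1/2) * (weak_grad u x $ i + weak_grad v x $ i))" for i
  proof -
    have "(\<lambda>x. weak_grad u x $ i) \<in> borel_measurable lebesgue" "(\<lambda>x. weak_grad v x $ i) \<in> borel_measurable lebesgue"
      "integrable lebesgue (\<lambda>x. norm (weak_grad u x $ i) powr p)" "integrable lebesgue (\<lambda>x. norm (weak_grad v x $ i) powr p)"
      using in_Lp_weak_grad[OF u p0, of i] in_Lp_weak_grad[OF v p0, of i] by (auto simp: in_Lp_def)
    from integrable_norm_powr_midpoint[OF p this] this(1,2) show ?thesis by (simp add: in_Lp_def)
  qed
  have "continuous_on UNIV ?w" using u v by (auto simp: D1p_def intro!: continuous_intros)
  then show w: "?w \<in> D1p p" using wd Lp continuous_imp_locally_integrable unfolding D1p_def by blast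
  have "AE x in lebesgue. \<forall>i\<in>UNIV. weak_grad ?w x $ i = (1/2) * (weak_grad u x $ i + weak_grad v x $ i)"
    by (intro AE_finite_allI finite weak_partial_deriv_unique[OF weak_partial_deriv_weak_grad[OF w p0] wd])
  then show "AE x in lebesgue. weak_grad ?w x = (1/2) *\<^sub>R (weak_grad u x + weak_grad v x)"
    by (rule eventually_mono) (simp add: vec_eq_iff)
qed

lemma weak_grad_AE_eq_imp_diff_const:
  fixes u v :: "real^'n::finite \<Rightarrow> real"
  assumes p: "0 < p" and u: "u \<in> D1p p" and v: "v \<in> D1p p"
    and eq: "AE x in lebesgue. weak_grad u x = weak_grad v x"
  shows "u x - v x = u 0 - v 0"
proof (rule continuous_weak_gradient_0_imp_const[of "\<lambda>x. u x - v x"])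
  show "continuous_on UNIV (\<lambda>x. u x - v x)"
    using u v by (auto simp: D1p_def intro!: continuous_intros)
  fix i and \<phi> :: "real^'n \<Rightarrow> real" assume \<phi>: "test_function \<phi>"
  let ?g = "\<lambda>(u :: real^'n \<Rightarrow> real) x. weak_grad u x $ i"
  have wd: "weak_partial_deriv i u (?g u)" "weak_partial_deriv i v (?g v)"
    using u v p by (auto intro: weak_partial_deriv_weak_grad)
  have "integrable lebesgue (\<lambda>x. u x * partial_deriv i \<phi> x)" "integrable lebesgue (\<lambda>x. v x * partial_deriv i \<phi> x)"
    using u v by (auto simp: D1p_def intro!: integrable_mult_test_function test_function_partial_deriv \<phi>)
  then have "(LINT x|lebesgue. (u x - v x) * partial_deriv i \<phi> x)
      = (LINT x|lebesgue. u x * partial_deriv i \<phi> x) - (LINT x|lebesgue. v x * partial_deriv i \<phi> x)"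
    by (simp add: left_diff_distrib)
  also have "\<dots> = (LINT x|lebesgue. ?g v x * \<phi> x) - (LINT x|lebesgue. ?g u x * \<phi> x)"
    using wd \<phi> by (simp add: weak_partial_deriv_def)
  also have "(LINT x|lebesgue. ?g v x * \<phi> x) = (LINT x|lebesgue. ?g u x * \<phi> x)"
  proof (rule integral_cong_AE)
    show "(\<lambda>x. ?g v x * \<phi> x) \<in> borel_measurable lebesgue" "(\<lambda>x. ?g u x * \<phi> x) \<in> borel_measurable lebesgue"
      using wd integrable_mult_test_function[OF _ \<phi>] by (auto simp: weak_partial_deriv_def)
    show "AE x in lebesgue. ?g v x * \<phi> x = ?g u x * \<phi> x"
      using eq by (rule eventually_mono) simp
  qed
  finally show "(LINT x|lebesgue. (u x - v x) * partial_deriv i \<phi> x) = 0" by simp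
qed

lemma grad_norm_midpoint_imp_diff_const:
  fixes u v :: "real^'n::finite \<Rightarrow> real"
  assumes p: "1 < p" and u: "u \<in> D1p p" and v: "v \<in> D1p p"
    and eq: "grad_norm p u = grad_norm p v"
    and le: "grad_norm p u \<le> grad_norm p (\<lambda>x. (1/2) * (u x + v x))"
  shows "u x - v x = u 0 - v 0"
proof (rule weak_grad_AE_eq_imp_diff_const[OF _ u v])
  show p0: "0 < p" using p by simp
  let ?w = "\<lambda>x. (1/2) * (u x + v x)"
  let ?I = "\<lambda>u. LINT x|lebesgue. norm (weak_grad u x) powr p"
  note w = D1p_midpoint[OF p u v]
  \<comment> \<open>Undoes the root in \<open>grad_norm\<close>: the power \<open>1 / p\<close> is
    strictly increasing on nonnegative numbers.\<close>
  have mono: "?I f \<le> ?I h" if "grad_norm p f \<le> grad_norm p h" for f h :: "real^'n \<Rightarrow> real"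
  proof (rule ccontr)
    assume "\<not> ?I f \<le> ?I h"
    then have "?I h powr (1 / p) < ?I f powr (1 / p)" using p0 by (intro powr_less_mono2) auto
    then show False using that by (simp add: grad_norm_def)
  qed
  have "?I ?w = (LINT x|lebesgue. norm ((1/2) *\<^sub>R (weak_grad u x + weak_grad v x)) powr p)"
  proof (rule integral_cong_AE)
    show "(\<lambda>x. norm (weak_grad ?w x) powr p) \<in> borel_measurable lebesgue"
      using integrable_weak_grad[OF w(1) p0] by blast
    show "(\<lambda>x. norm ((1/2) *\<^sub>R (weak_grad u x + weak_grad v x)) powr p) \<in> borel_measurable lebesgue"
      using measurable_weak_grad[OF u p0] measurable_weak_grad[OF v p0] by measurable
    show "AE x in lebesgue. norm (weak_grad ?w x) powr p = norm ((1/2) *\<^sub>R (weak_grad u x + weak_grad v x)) powr p"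
      using w(2) by (rule eventually_mono) simp
  qed
  moreover have "?I u \<le> ?I ?w" "?I u = ?I v" using mono le eq by (auto intro: antisym)
  ultimately show "AE x in lebesgue. weak_grad u x = weak_grad v x"
    using AE_eq_if_Lp_midpoint[OF p measurable_weak_grad[OF u p0] measurable_weak_grad[OF v p0]
        integrable_weak_grad[OF u p0] integrable_weak_grad[OF v p0]] by simp
qed

section \<open>The best constant\<close>

text \<open>The infimum is itself an admissible constant. For positive gradient norm one divides;
  the norm is real, so multiplying back recovers the seminorm. For gradient norm 0 some admissible
  constant must exist, which is what finiteness provides: the infimum of the empty set is infinite,
  and infinity times 0 is 0 in \<open>ennreal\<close>.\<close>

lemma morrey_seminorm_le_best_constant:
  assumes u: "u \<in> D1p p" and fin: "best_constant p \<rho> \<noteq> \<infinity>"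
  shows "morrey_seminorm p \<rho> u \<le> best_constant p \<rho> * ennreal (grad_norm p u)"
proof -
  let ?X = "{C. \<forall>u\<in>D1p p. morrey_seminorm p \<rho> u \<le> C * ennreal (grad_norm p u)}"
  let ?s = "morrey_seminorm p \<rho> u" and ?t = "ennreal (grad_norm p u)"
  have le: "?s \<le> C * ?t" if "C \<in> ?X" for C using that u by blast
  show ?thesis
  proof (cases "?t = 0")
    case True
    have "?X \<noteq> {}" using fin unfolding best_constant_def by (metis Inf_empty infinity_ennreal_def)
    then obtain C where "C \<in> ?X" by blast
    from le[OF this] show ?thesis by (simp add: True)
  next
    case False
    then have "?s / ?t \<le> C" if "C \<in> ?X" for C
      using le[OF that] by (intro divide_le_posI_ennreal) (auto simp: mult.commute zero_less_iff_neq_zero)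
    then have "?s / ?t \<le> best_constant p \<rho>" unfolding best_constant_def by (rule Inf_greatest)
    then have "?s / ?t * ?t \<le> best_constant p \<rho> * ?t" by (rule mult_right_mono) simp
    moreover have "?s / ?t * ?t = ?s" using False by (simp add: ennreal_divide_times ennreal_mult_divide_eq)
    ultimately show ?thesis by simp
  qed
qed

lemma id_similarity: "id \<in> similarities"
  unfolding similarities_def mem_Collect_eq
proof (intro exI conjI)
  show "(0::real) < 1" by simp
  show "orthogonal_matrix (mat 1 :: real^'a^'a)" by (rule orthogonal_matrix_id)
  show "id = (\<lambda>y :: real^'a. 1 *\<^sub>R (mat 1 *v y) + 0)" by auto
qed

text \<open>If the best constant were \<open>0\<close>, then \<open>\<rho>\<close> would annihilate all test functions, hence by truncation
  the coordinate functions.\<close>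

lemma best_constant_pos:
  fixes \<rho> :: "(real^'n::finite) set \<Rightarrow> real"
  assumes p: "0 < p" and \<rho>: "admissible \<rho>"
  shows "best_constant p \<rho> \<noteq> 0"
proof
  assume C0: "best_constant p \<rho> = 0"
  let ?K = "signed_support \<rho>"
  have sbm: "signed_borel_measure \<rho>" and K: "compact ?K" and nz: "signed_integral \<rho> (\<lambda>y. y) \<noteq> 0"
    using \<rho> by (auto simp: admissible_def)
  have conc: "concentrated_on \<rho> ?K" by (rule concentrated_on_signed_support[OF sbm])
  have null: "signed_integral \<rho> \<phi> = 0" if "test_function \<phi>" for \<phi>
  proof -
    have "\<phi> \<in> D1p p" by (rule test_function_in_D1p[OF that p])
    then have "morrey_seminorm p \<rho> \<phi> \<le> 0"
      using morrey_seminorm_le_best_constant[of \<phi> p \<rho>] C0 by simp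
    moreover have "ennreal (morrey_ratio p (push_forward id \<rho>) \<phi>) \<le> morrey_seminorm p \<rho> \<phi>"
      unfolding morrey_seminorm_def by (rule SUP_upper[OF id_similarity])
    moreover have "push_forward id \<rho> = \<rho>" by (simp add: push_forward_def fun_eq_iff)
    ultimately have "morrey_ratio p \<rho> \<phi> \<le> 0" by (simp add: ennreal_eq_0_iff)
    \<comment> \<open>The nonzero first moment makes the denominator of the ratio positive; with a
      zero denominator the ratio would be 0 regardless of \<phi>.\<close>
    then have "\<bar>signed_integral \<rho> \<phi>\<bar> \<le> 0"
      using nz by (simp add: morrey_ratio_def divide_le_0_iff)
    then show ?thesis by simp
  qed
  \<comment> \<open>The support lies in the open box, where the bumps tend to 1, so the truncation
    disappears in the limit.\<close>
  obtain b where b: "?K \<subseteq> box (- b) b"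
    using bounded_subset_box_symmetric[OF compact_imp_bounded[OF K]] by blast
  have comp: "signed_integral \<rho> (\<lambda>x. x $ j) = 0" for j
  proof -
    have "(\<lambda>m. signed_integral \<rho> (\<lambda>x. x $ j * box_bump m (- b) b x)) \<longlonglongrightarrow> signed_integral \<rho> (\<lambda>x. x $ j)"
    proof (rule signed_integral_tendsto[OF sbm conc K])
      show "continuous_on UNIV (\<lambda>x. x $ j * box_bump m (- b) b x)" for m
        by (rule test_functionD(2)[OF test_function_component_bump])
      show "continuous_on UNIV (\<lambda>x::real^'n. x $ j)" by (intro continuous_intros)
      show "(\<lambda>m. x $ j * box_bump m (- b) b x) \<longlonglongrightarrow> x $ j" if "x \<in> ?K" for x
        using tendsto_mult[OF tendsto_const box_bump_tendsto[of "- b" b x], of "x $ j"] that b by auto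
      show "\<bar>x $ j * box_bump m (- b) b x\<bar> \<le> \<bar>x $ j\<bar>" for m x
        using box_bump_bounds[of m "- b" b x] by (simp add: abs_mult mult_left_le)
    qed
    moreover have "signed_integral \<rho> (\<lambda>x. x $ j * box_bump m (- b) b x) = 0" for m
      by (rule null[OF test_function_component_bump])
    ultimately show ?thesis using LIMSEQ_unique[OF _ tendsto_const] by simp
  qed
  \<comment> \<open>Links the vector-valued first moment with its coordinates. It is stated for a
    general \<sigma> so as to apply to \<rho> and to its negative.\<close>
  have "(LINT x|jordan_pos \<sigma>. x) $ j = (LINT x|jordan_pos \<sigma>. x $ j)"
    if "signed_borel_measure \<sigma>" "concentrated_on \<sigma> ?K" for \<sigma> :: "(real^'n) set \<Rightarrow> real" and j
    using integral_bounded_linear[OF bounded_linear_vec_nth integrable_jordan_pos[OF that K continuous_on_id], of j]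
    by simp
  then have "signed_integral \<rho> (\<lambda>x. x) $ j = signed_integral \<rho> (\<lambda>x. x $ j)" for j
    unfolding signed_integral_def
    using sbm conc by (simp add: signed_borel_measure_uminus concentrated_on_uminus)
  then show False using nz comp by (simp add: vec_eq_iff)
qed

theorem corollary4p2:
  fixes p :: real
    and \<rho> \<mu> :: "(real^'n::finite) set \<Rightarrow> real"
    and S :: "real^'n \<Rightarrow> real^'n"
    and u\<^sub>1 u\<^sub>2 :: "real^'n \<Rightarrow> real"
  assumes "real CARD('n) < p"
    and "admissible \<rho>"
    and "S \<in> similarities"
    and "\<mu> = push_forward S \<rho>"
    and "extremal p \<rho> u\<^sub>1"
    and "extremal p \<rho> u\<^sub>2"
    and "morrey_seminorm p \<rho> u\<^sub>1 =
      ennreal (\<bar>signed_integral \<mu> u\<^sub>1\<bar> / norm (signed_integral \<mu> (\<lambda>x. x)) powr (1 - real CARD('n) / p))"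
    and "morrey_seminorm p \<rho> u\<^sub>2 =
      ennreal (\<bar>signed_integral \<mu> u\<^sub>2\<bar> / norm (signed_integral \<mu> (\<lambda>x. x)) powr (1 - real CARD('n) / p))"
    and "signed_integral \<mu> u\<^sub>1 = signed_integral \<mu> u\<^sub>2"
  shows "\<exists>c. \<forall>x. u\<^sub>1 x - u\<^sub>2 x = c"
proof -
  let ?v = "\<lambda>x. (1/2) * (u\<^sub>1 x + u\<^sub>2 x)" and ?C = "best_constant p \<rho>"
  let ?s = "morrey_seminorm p \<rho>" and ?g = "\<lambda>u. ennreal (grad_norm p u)"
  have "real CARD('n) \<ge> 1" by (simp add: Suc_le_eq)
  then have p: "1 < p" "0 < p" using assms(1) by linarith+
  have u: "u\<^sub>1 \<in> D1p p" "u\<^sub>2 \<in> D1p p" and ext: "?s u\<^sub>1 = ?C * ?g u\<^sub>1" "?s u\<^sub>2 = ?C * ?g u\<^sub>2"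
    using assms(5,6) by (auto simp: extremal_def)
  have v: "?v \<in> D1p p" by (rule D1p_midpoint(1)[OF p(1) u])
  have s_eq: "?s u\<^sub>1 = ?s u\<^sub>2" using assms(7-9) by simp
  have s_le: "?s u\<^sub>1 \<le> ?s ?v"
  proof -
    have \<rho>: "signed_borel_measure \<rho>" "compact (signed_support \<rho>)" using assms(2) by (auto simp: admissible_def)
    have S: "continuous_on UNIV S" by (rule continuous_on_similarity[OF assms(3)])
    then have S': "S \<in> borel_measurable borel" by (rule borel_measurable_continuous_onI)
    \<comment> \<open>Additivity rests on integrability under both Jordan parts, which holds because
      both functions are continuous and \<mu> is carried by the compact image of the support under
      \<open>S\<close>.\<close>
    have "signed_integral \<mu> (\<lambda>x. u\<^sub>1 x + u\<^sub>2 x) = signed_integral \<mu> u\<^sub>1 + signed_integral \<mu> u\<^sub>2"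
      unfolding assms(4)
    proof (rule signed_integral_add)
      show "signed_borel_measure (push_forward S \<rho>)" by (rule signed_borel_measure_push_forward[OF \<rho>(1) S'])
      show "concentrated_on (push_forward S \<rho>) (S ` signed_support \<rho>)"
        by (rule concentrated_on_push_forward[OF concentrated_on_signed_support[OF \<rho>(1)] S'])
      show "compact (S ` signed_support \<rho>)"
        by (rule compact_continuous_image[OF continuous_on_subset[OF S] \<rho>(2)]) simp
    qed (use u in \<open>auto simp: D1p_def\<close>)
    moreover have "signed_integral \<mu> ?v = (1/2) * signed_integral \<mu> (\<lambda>x. u\<^sub>1 x + u\<^sub>2 x)"
      unfolding signed_integral_def by (simp only: integral_mult_right_zero right_diff_distrib)
    ultimately have "signed_integral \<mu> ?v = signed_integral \<mu> u\<^sub>1" using assms(9) by simp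
    then have "?s u\<^sub>1 = ennreal (morrey_ratio p (push_forward S \<rho>) ?v)"
      using assms(4,7) by (simp add: morrey_ratio_def)
    also have "\<dots> \<le> ?s ?v" unfolding morrey_seminorm_def by (rule SUP_upper[OF assms(3)])
    finally show ?thesis .
  qed
  have nonneg: "0 \<le> grad_norm p u" for u :: "real^'n \<Rightarrow> real" by (simp add: grad_norm_def)
  have "grad_norm p u\<^sub>1 = grad_norm p u\<^sub>2 \<and> grad_norm p u\<^sub>1 \<le> grad_norm p ?v"
  proof (cases "?C = \<infinity>")
    case True
    have "?s u\<^sub>1 \<noteq> \<infinity>" "?s u\<^sub>2 \<noteq> \<infinity>" using assms(7,8) by simp_all
    then have "?g u\<^sub>1 = 0" "?g u\<^sub>2 = 0" using ext True by (auto simp: ennreal_top_mult split: if_splits)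
    then have "grad_norm p u\<^sub>1 = 0" "grad_norm p u\<^sub>2 = 0"
      using nonneg[of u\<^sub>1] nonneg[of u\<^sub>2] by (simp_all add: ennreal_eq_0_iff)
    then show ?thesis using nonneg by simp
  next
    case False
    \<comment> \<open>Cancellation of a factor in \<open>ennreal\<close> breaks down at 0 and at
      infinity, so both are excluded.\<close>
    have C: "?C \<noteq> 0" "?C \<noteq> top" using best_constant_pos[OF p(2) assms(2)] False by auto
    have "?C * ?g u\<^sub>1 = ?C * ?g u\<^sub>2" using s_eq ext by simp
    moreover have "?C * ?g u\<^sub>1 \<le> ?C * ?g ?v"
      using s_le morrey_seminorm_le_best_constant[OF v False] ext by simp
    ultimately have "?g u\<^sub>1 = ?g u\<^sub>2" "?g u\<^sub>1 \<le> ?g ?v"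
      using C by (auto simp: ennreal_mult_cancel_left ennreal_mult_le_mult_iff)
    then show ?thesis using nonneg by (simp add: ennreal_le_iff)
  qed
  then show ?thesis using grad_norm_midpoint_imp_diff_const[OF p(1) u] by blast
qed

end
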